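(* Let $P$ be a $d$-polytope with $d\ge1$, let $\mathcal{C}_P$ be the $V(P)$-pointed triangulation of $P$, and let $P(n)$ be the $V(P)$-polytope numbers. Then for all $n\ge 0$ $$P(n)=\sum_{i=1}^{d}(-1)^{d-i}\,b_i\,\alpha^i(n),$$ where $b_i$ is the number of $i$-simplexes $\alpha^i$ in $\mathcal{C}_P$ such that $\mathbf{v}_P\in\alpha^i$ and $\alpha^i\cap int(P)\neq\emptyset$.
   Context: A $d$-polytope is a $d$-dimensional convex hull of finitely many points in some $\mathbb{R}^e$. $int(P)$ is the set of points of $P$ lying in no proper face of $P$ (its relative interior). Pointed triangulation: let $\mathbf{c}\mathbf{x}$ be a linear function taking distinct values at distinct vertexes of $P$. For each nonempty face $F$ of $P$ (including $P$) let the apex $\mathbf{v}_F$ be the unique vertex of $F$ at which $\mathbf{c}\mathbf{x}$ attains its minimum on $F$; $V(P)$ denotes this system of apexes. The $V(P)$-pointed triangulation of $P$ is $$\mathcal{C}_P=\{\emptyset\}\cup\big\{conv(\{\mathbf{v}_{G_1},\ldots,\mathbf{v}_{G_k}\}) : 1\le k\le d+1,\ G_1\supsetneq\cdots\supsetneq G_k \text{ nonempty faces of } P,\ \mathbf{v}_{G_i}\notin G_{i+1}\ (1\le i<k)\big\},$$ which is a triangulation of $P$. Polytope numbers: let $\mathcal{F}(P)$ be the set of nonempty faces of $P$, including $P$. With the apexes above, the $V(P)$-polytope numbers $P(n)$ and interior polytope numbers $P(n)^\sharp$ are defined by double induction on $d=\dim P$ and $n\ge0$ (each face is a polytope with the inherited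 apexes): if $d=0$, $P(0)=P(0)^\sharp=0$ and $P(n)=P(n)^\sharp=1$ for $n\ge1$; if $d\ge1$, $P(0)=0$, $P(1)=1$, $P(0)^\sharp=P(1)^\sharp=0$, and for $n\ge2$ $$P(n)=P(n-1)+\sum_{F\in\mathcal{F}(P),\ \mathbf{v}_P\notin F}F(n)^\sharp,\qquad P(n)^\sharp=P(n)-\sum_{F\in\mathcal{F}(P)\setminus\{P\}}F(n)^\sharp .$$ $\alpha^i(n)$ denotes the polytope numbers of an $i$-simplex; explicitly $\alpha^i(n)=\binom{n+i-1}{i}$ for $n\ge1$ and $\alpha^i(0)=0$. *)

theory Defs
  imports "HOL-Analysis.Analysis"
begin

section \<open>Faces, generic linear functions and apexes\<close>

definition faces :: "'a::euclidean_space set \<Rightarrow> 'a set set" where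
  "faces P = {F. F face_of P \<and> F \<noteq> {}}"

text \<open>
  Points lying in no proper face; by \<open>polytope_int_eq_rel_interior\<close> below this is the relative
  interior.  For a point \<open>P = {v}\<close> the only face other than \<open>P\<close> is empty, so the interior is \<open>P\<close>.
\<close>

definition polytope_int :: "'a::euclidean_space set \<Rightarrow> 'a set" where
  "polytope_int P = {x \<in> P. \<forall>F. F face_of P \<and> F \<noteq> P \<longrightarrow> x \<notin> F}"

text \<open>The linear function \<open>x \<mapsto> c \<bullet> x\<close> takes distinct values at distinct vertices of \<open>P\<close>.\<close>

definition generic_on :: "'a::euclidean_space \<Rightarrow> 'a set \<Rightarrow> bool" where
  "generic_on c P \<longleftrightarrow> inj_on (\<lambda>v. c \<bullet> v) {v. v extreme_point_of P}"

text \<open>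
  The description is meaningful (\<open>ex1_apex\<close>) for nonempty faces of a polytope on which \<open>c\<close> is
  generic; faces inherit genericity (\<open>generic_on_face\<close>).
\<close>

definition apex :: "'a::euclidean_space \<Rightarrow> 'a set \<Rightarrow> 'a" where
  "apex c F = (THE v. v extreme_point_of F \<and> (\<forall>x\<in>F. c \<bullet> v \<le> c \<bullet> x))"

lemma polytope_int_eq_rel_interior:
  assumes "polytope P"
  shows "polytope_int P = rel_interior P"
proof
  show "polytope_int P \<subseteq> rel_interior P"
    unfolding polytope_int_def rel_interior_of_polyhedron[OF polytope_imp_polyhedron[OF assms]]
    by (auto simp: facet_of_def)
  show "rel_interior P \<subseteq> polytope_int P"
  proof
    fix x assume x: "x \<in> rel_interior P"
    have "x \<notin> F" if "F face_of P" "F \<noteq> P" for F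
      using face_of_disjoint_rel_interior[OF that] x by blast
    then show "x \<in> polytope_int P"
      using x rel_interior_subset by (auto simp: polytope_int_def)
  qed
qed

lemma ex1_apex:
  assumes "polytope F" "F \<noteq> {}" "generic_on c F"
  shows "\<exists>!v. v extreme_point_of F \<and> (\<forall>x\<in>F. c \<bullet> v \<le> c \<bullet> x)"
proof -
  have cF: "compact F"
    using assms(1) by (rule polytope_imp_compact)
  have "continuous_on F (\<lambda>x. c \<bullet> x)" by (intro continuous_intros)
  then obtain m where m: "m \<in> F" "\<And>x. x \<in> F \<Longrightarrow> c \<bullet> m \<le> c \<bullet> x"
    using continuous_attains_inf[OF cF assms(2)] by blast
  let ?G = "F \<inter> {x. c \<bullet> x = c \<bullet> m}"
  have G: "?G face_of F"
    using polytope_imp_convex[OF assms(1)] m(2)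
    by (intro face_of_Int_supporting_hyperplane_ge) auto
  have "polytope ?G" using assms(1) G by (rule face_of_polytope_polytope)
  then obtain v where v: "v extreme_point_of ?G"
    using extreme_point_exists_convex[of ?G] m(1) polytope_imp_compact polytope_imp_convex
    by blast
  then have "v extreme_point_of F \<and> (\<forall>x\<in>F. c \<bullet> v \<le> c \<bullet> x)"
    using G m(2) by (auto simp: extreme_point_of_face)
  moreover have "w = v" if "w extreme_point_of F \<and> (\<forall>x\<in>F. c \<bullet> w \<le> c \<bullet> x)" for w
  proof -
    have "c \<bullet> w = c \<bullet> v"
      using that calculation by (metis antisym extreme_point_of_def)
    then show ?thesis
      using assms(3) that calculation by (auto simp: generic_on_def inj_on_def)
  qed
  ultimately show ?thesis by blast
qed

lemma
  assumes "polytope F" "F \<noteq> {}" "generic_on c F"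
  shows apex_extreme_point: "apex c F extreme_point_of F"
    and apex_le: "x \<in> F \<Longrightarrow> c \<bullet> apex c F \<le> c \<bullet> x"
    and apex_in: "apex c F \<in> F"
  using theI'[OF ex1_apex[OF assms]] by (auto simp: apex_def extreme_point_of_def)

lemma generic_on_face:
  assumes "generic_on c P" "F face_of P"
  shows "generic_on c F"
  using assms by (auto simp: generic_on_def inj_on_def extreme_point_of_face)

lemma facesD:
  assumes "F \<in> faces P" "polytope P"
  shows "polytope F" "F \<noteq> {}" "F face_of P"
  using assms face_of_polytope_polytope by (auto simp: faces_def)

section \<open>The pointed triangulation\<close>

text \<open>
  Cells are convex hulls of apexes along chains \<open>Gs = [G\<^sub>1, \<dots>, G\<^sub>k]\<close>, listed from the largest face
  to the smallest; only consecutive faces have to satisfy \<open>apex c G\<^sub>i \<notin> G\<^bsub>i+1\<^esub>\<close>.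
\<close>

definition pointed_triangulation :: "'a::euclidean_space \<Rightarrow> 'a set \<Rightarrow> 'a set set" where
  "pointed_triangulation c P =
     insert {} {convex hull (apex c ` set Gs) | Gs.
       1 \<le> length Gs \<and> int (length Gs) \<le> aff_dim P + 1 \<and> set Gs \<subseteq> faces P \<and>
       successively (\<lambda>G H. H \<subset> G \<and> apex c G \<notin> H) Gs}"

definition interior_apex_simplexes :: "'a::euclidean_space \<Rightarrow> 'a set \<Rightarrow> nat \<Rightarrow> 'a set set" where
  "interior_apex_simplexes c P i =
     {S \<in> pointed_triangulation c P.
        int i simplex S \<and> apex c P \<in> S \<and> S \<inter> polytope_int P \<noteq> {}}"

lemma finite_pointed_triangulation:
  assumes "polytope P"
  shows "finite (pointed_triangulation c P)"
proof -
  have fin: "finite (faces P)"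
    using finite_polytope_faces[OF assms] by (rule finite_subset[rotated]) (auto simp: faces_def)
  have "pointed_triangulation c P \<subseteq> insert {} ((\<lambda>A. convex hull (apex c ` A)) ` Pow (faces P))"
    by (auto simp: pointed_triangulation_def)
  then show ?thesis
    using fin by (meson finite_Pow_iff finite_imageI finite_insert finite_subset)
qed

section \<open>Polytope numbers\<close>

text \<open>
  The values are integers because the interior numbers are defined by subtraction.
  The guard in the first branch makes the recursion total: outside of nonempty polytopes on
  which \<open>c\<close> is generic the values are irrelevant.  The unguarded recursion is recorded below
  as \<open>polytope_num_rec\<close> and \<open>interior_num_rec\<close>.
\<close>

function polytope_num :: "'a::euclidean_space \<Rightarrow> 'a set \<Rightarrow> nat \<Rightarrow> int"
  and interior_num :: "'a \<Rightarrow> 'a set \<Rightarrow> nat \<Rightarrow> int" where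
  "polytope_num c P n =
     (if \<not> (polytope P \<and> P \<noteq> {} \<and> generic_on c P) then 0
      else if n = 0 then 0
      else if aff_dim P = 0 \<or> n = 1 then 1
      else polytope_num c P (n - 1) + (\<Sum>F\<in>{F \<in> faces P. apex c P \<notin> F}. interior_num c F n))"
| "interior_num c P n =
     (if \<not> (polytope P \<and> P \<noteq> {} \<and> generic_on c P) then 0
      else if aff_dim P = 0 then (if n = 0 then 0 else 1)
      else if n \<le> 1 then 0
      else polytope_num c P n - (\<Sum>F\<in>faces P - {P}. interior_num c F n))"
  by pat_completeness auto

lemma face_dim_less:
  assumes "polytope P" "F \<in> faces P" "F \<noteq> P"
  shows "nat (aff_dim F + 1) < nat (aff_dim P + 1)"
proof -
  have "aff_dim F < aff_dim P"
    using assms face_of_aff_dim_lt polytope_imp_convex by (auto simp: faces_def)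
  then show ?thesis using aff_dim_geq[of F] by linarith
qed

termination
proof (relation "measures
    [\<lambda>x. case x of Inl (c, P, n) \<Rightarrow> nat (aff_dim P + 1) | Inr (c, P, n) \<Rightarrow> nat (aff_dim P + 1),
     \<lambda>x. case x of Inl (c, P, n) \<Rightarrow> n | Inr (c, P, n) \<Rightarrow> n,
     \<lambda>x. case x of Inl _ \<Rightarrow> 0 | Inr _ \<Rightarrow> 1]", goal_cases)
  case (3 c P n F)
  then have "polytope P" "F \<in> faces P" "F \<noteq> P" using apex_in by blast+
  then show ?case using face_dim_less[of P F] by simp
next
  case (5 c P n F)
  then have "polytope P" "F \<in> faces P" "F \<noteq> P" by blast+
  then show ?case using face_dim_less[of P F] by simp
qed auto

declare polytope_num.simps [simp del] interior_num.simps [simp del]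

lemma polytope_num_rec:
  assumes "polytope P" "generic_on c P"
  shows "aff_dim P = 0 \<Longrightarrow> polytope_num c P n = (if n = 0 then 0 else 1)"
    and "aff_dim P \<ge> 1 \<Longrightarrow> polytope_num c P 0 = 0"
    and "aff_dim P \<ge> 1 \<Longrightarrow> polytope_num c P 1 = 1"
    and "aff_dim P \<ge> 1 \<Longrightarrow> n \<ge> 2 \<Longrightarrow> polytope_num c P n =
           polytope_num c P (n - 1) + (\<Sum>F\<in>{F \<in> faces P. apex c P \<notin> F}. interior_num c F n)"
  using assms by (subst polytope_num.simps, force)+

lemma interior_num_rec:
  assumes "polytope P" "generic_on c P"
  shows "aff_dim P = 0 \<Longrightarrow> interior_num c P n = (if n = 0 then 0 else 1)"
    and "aff_dim P \<ge> 1 \<Longrightarrow> interior_num c P 0 = 0"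
    and "aff_dim P \<ge> 1 \<Longrightarrow> interior_num c P 1 = 0"
    and "aff_dim P \<ge> 1 \<Longrightarrow> n \<ge> 2 \<Longrightarrow> interior_num c P n =
           polytope_num c P n - (\<Sum>F\<in>faces P - {P}. interior_num c F n)"
  using assms by (subst interior_num.simps, force)+

section \<open>Simplex numbers\<close>

definition simplex_num :: "nat \<Rightarrow> nat \<Rightarrow> nat" where
  "simplex_num i n = (if n = 0 then 0 else (n + i - 1) choose i)"

text \<open>
  The rest of this section checks that \<open>simplex_num i\<close> is indeed the sequence of polytope
  numbers of every \<open>i\<close>-simplex.
\<close>

lemma sum_Pow_card:
  fixes g :: "nat \<Rightarrow> nat"
  assumes "finite X"
  shows "(\<Sum>B\<in>Pow X. g (card B)) = (\<Sum>j\<le>card X. (card X choose j) * g j)"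
proof -
  have "(\<Sum>B\<in>Pow X. g (card B)) = (\<Sum>j\<le>card X. \<Sum>B | B \<in> Pow X \<and> card B = j. g (card B))"
    using assms by (intro sum.group[symmetric]) (auto simp: card_mono)
  also have "\<dots> = (\<Sum>j\<le>card X. (card X choose j) * g j)"
    using n_subsets[OF assms] by (intro sum.cong) (auto simp: Pow_def)
  finally show ?thesis .
qed

lemma sum_subsets_choose:
  assumes "finite X" "X \<noteq> {}"
  shows "(\<Sum>B\<in>Pow X - {{}}. m choose (card B - 1)) = (m + card X) choose (card X - 1)"
proof -
  obtain k where k: "card X = Suc k"
    using assms by (metis card_gt_0_iff gr0_implies_Suc)
  define g where "g j = (if j = 0 then 0 else m choose (j - 1))" for j :: nat
  have "(\<Sum>B\<in>Pow X - {{}}. m choose (card B - 1)) = (\<Sum>B\<in>Pow X - {{}}. g (card B))"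
    using assms by (intro sum.cong) (auto simp: g_def card_eq_0_iff dest: finite_subset)
  also have "\<dots> = (\<Sum>B\<in>Pow X. g (card B))"
    using assms by (intro sum.mono_neutral_left) (auto simp: g_def)
  also have "\<dots> = (\<Sum>j\<le>Suc k. (Suc k choose j) * g j)"
    by (simp add: sum_Pow_card[OF assms(1)] k)
  also have "\<dots> = (\<Sum>j\<le>k. (Suc k choose Suc j) * g (Suc j))"
    by (subst sum.atMost_Suc_shift) (simp add: g_def)
  also have "\<dots> = (\<Sum>j\<le>k. (m choose j) * (Suc k choose (k - j)))"
  proof (intro sum.cong refl)
    fix j assume "j \<in> {..k}"
    then have "Suc k choose Suc j = Suc k choose (k - j)"
      by (subst binomial_symmetric) auto
    then show "(Suc k choose Suc j) * g (Suc j) = (m choose j) * (Suc k choose (k - j))"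
      by (simp add: g_def)
  qed
  also have "\<dots> = (m + card X) choose (card X - 1)"
    by (simp only: vandermonde k diff_Suc_1)
  finally show ?thesis .
qed

lemma polytope_num_affine_independent:
  assumes "\<not> affine_dependent C" "card C = Suc d" "generic_on c (convex hull C)"
  shows "polytope_num c (convex hull C) n = int (simplex_num d n) \<and>
         (n \<ge> 2 \<longrightarrow> interior_num c (convex hull C) n = int ((n - 2) choose d))"
  using assms
proof (induction d arbitrary: C n rule: less_induct)
  case (less d)
  let ?P = "convex hull C"
  have fin: "finite C" using less.prems(1) aff_independent_finite by blast
  have P: "polytope ?P" using fin by (auto simp: polytope_def)
  have ad: "aff_dim ?P = int d"
    using aff_dim_affine_independent[OF less.prems(1)] less.prems(2)
    by (simp add: aff_dim_convex_hull)
  have ne: "?P \<noteq> {}" using less.prems(2) by auto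
  have ind: "\<not> affine_dependent B" if "B \<subseteq> C" for B
    using less.prems(1) that affine_dependent_subset by blast
  have faces: "faces ?P = (\<lambda>B. convex hull B) ` (Pow C - {{}})"
    using face_of_convex_hull_affine_independent[OF less.prems(1)] by (auto simp: faces_def)
  have vert: "{x. x extreme_point_of convex hull B} = B" if "B \<subseteq> C" for B
    using extreme_point_of_convex_hull_affine_independent[OF ind[OF that]] by blast
  have inj: "inj_on (\<lambda>B. convex hull B) (Pow C)"
    using vert by (intro inj_onI) (metis PowD)
  show ?case
  proof (cases "d = 0")
    case True
    then show ?thesis
      using ad polytope_num_rec(1)[OF P less.prems(3)] interior_num_rec(1)[OF P less.prems(3)]
      by (simp add: simplex_num_def)
  next
    case False
    let ?v = "apex c ?P"
    have v: "?v extreme_point_of ?P" using apex_extreme_point[OF P ne less.prems(3)] .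
    have vC: "?v \<in> C" using v extreme_point_of_convex_hull by blast
    have vB: "?v \<in> convex hull B \<longleftrightarrow> ?v \<in> B" if "B \<subseteq> C" for B
    proof
      assume "?v \<in> convex hull B"
      moreover have "convex hull B face_of ?P"
        using that face_of_convex_hull_affine_independent[OF less.prems(1)] by blast
      ultimately have "?v extreme_point_of convex hull B"
        using v extreme_point_of_face by blast
      then show "?v \<in> B" by (rule extreme_point_of_convex_hull)
    qed (rule hull_inc)
    have IH: "interior_num c (convex hull B) n = int ((n - 2) choose (card B - 1))"
      if "B \<subset> C" "B \<noteq> {}" "n \<ge> 2" for B n
    proof -
      have cB: "card B > 0" using that fin by (meson card_gt_0_iff finite_subset psubset_imp_subset)
      have "card B < card C" using that fin by (simp add: psubset_card_mono)
      then have "card B - 1 < d" using cB less.prems(2) by simp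
      moreover have "generic_on c (convex hull B)"
        using that face_of_convex_hull_affine_independent[OF less.prems(1)]
        by (intro generic_on_face[OF less.prems(3)]) blast
      ultimately show ?thesis
        using less.IH[of "card B - 1" B n] ind[of B] that cB by simp
    qed
    have num: "polytope_num c ?P n = int (simplex_num d n)" for n
    proof (induction n)
      case 0
      then show ?case
        using ad False polytope_num_rec(2)[OF P less.prems(3)] by (simp add: simplex_num_def)
    next
      case (Suc n)
      show ?case
      proof (cases "n = 0")
        case True
        then show ?thesis
          using ad False polytope_num_rec(3)[OF P less.prems(3)] by (simp add: simplex_num_def)
      next
        case n: False
        let ?X = "C - {?v}"
        have cX': "finite ?X" "card ?X = d"
          using fin vC less.prems(2) by simp_all
        have cX: "finite ?X" "card ?X = d" "?X \<noteq> {}"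
          using cX' False by (metis card.empty)+
        have "{F \<in> faces ?P. ?v \<notin> F} = (\<lambda>B. convex hull B) ` (Pow ?X - {{}})"
          unfolding faces using vB by blast
        then have "(\<Sum>F\<in>{F \<in> faces ?P. ?v \<notin> F}. interior_num c F (Suc n))
            = (\<Sum>B\<in>Pow ?X - {{}}. interior_num c (convex hull B) (Suc n))"
          by (simp add: sum.reindex inj_on_subset[OF inj] Diff_subset subset_iff)
        also have "\<dots> = (\<Sum>B\<in>Pow ?X - {{}}. int ((n - 1) choose (card B - 1)))"
          using vC n by (intro sum.cong refl) (subst IH, auto)
        also have "\<dots> = int ((n - 1 + d) choose (d - 1))"
          using sum_subsets_choose[OF cX(1,3), of "n - 1"] cX(2) by (metis of_nat_sum)
        finally have "polytope_num c ?P (Suc n) =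
            int (simplex_num d n) + int ((n - 1 + d) choose (d - 1))"
          using ad False n Suc polytope_num_rec(4)[OF P less.prems(3), of "Suc n"] by simp
        also have "\<dots> = int (simplex_num d (Suc n))"
        proof -
          obtain k l where "n = Suc k" "d = Suc l" using n False by (metis not0_implies_Suc)
          then show ?thesis by (simp add: simplex_num_def)
        qed
        finally show ?thesis .
      qed
    qed
    have "interior_num c ?P n = int ((n - 2) choose d)" if n: "n \<ge> 2"
    proof -
      have C: "C \<noteq> {}" using less.prems(2) by auto
      have sub: "Pow C - {{}} - {C} \<subseteq> Pow C" by blast
      have "faces ?P - {?P} = (\<lambda>B. convex hull B) ` (Pow C - {{}} - {C})"
        unfolding faces using inj by (auto simp: inj_on_def)
      then have "(\<Sum>F\<in>faces ?P - {?P}. interior_num c F n)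
          = (\<Sum>B\<in>Pow C - {{}} - {C}. interior_num c (convex hull B) n)"
        by (simp add: sum.reindex inj_on_subset[OF inj sub])
      also have "\<dots> = (\<Sum>B\<in>Pow C - {{}} - {C}. int ((n - 2) choose (card B - 1)))"
        using n by (intro sum.cong refl) (subst IH, auto)
      also have "\<dots> = (\<Sum>B\<in>Pow C - {{}}. int ((n - 2) choose (card B - 1)))
          - int ((n - 2) choose d)"
        using fin C less.prems(2) by (subst sum_diff1) auto
      also have "(\<Sum>B\<in>Pow C - {{}}. int ((n - 2) choose (card B - 1)))
          = int ((n - 2 + Suc d) choose d)"
        using sum_subsets_choose[OF fin C, of "n - 2"] less.prems(2)
        by (metis of_nat_sum diff_Suc_1)
      also have "(n - 2 + Suc d) choose d = simplex_num d n"
      proof -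
        have "n - 2 + Suc d = n + d - 1" using n by simp
        then show ?thesis using n by (simp add: simplex_num_def)
      qed
      finally show ?thesis
        using ad False n num interior_num_rec(4)[OF P less.prems(3), of n] by simp
    qed
    then show ?thesis using num by blast
  qed
qed

corollary polytope_num_simplex:
  assumes "int i simplex S" "generic_on c S"
  shows "polytope_num c S n = int (simplex_num i n)"
  using assms polytope_num_affine_independent[of _ i c n]
  by (auto simp: simplex_def)

end

theory Submission
  imports Defs
begin

text \<open>
  Both sides are compared through their first differences.  Write \<open>v\<close> for the apex of \<open>P\<close> and call
  a face \<open>H\<close> with \<open>v \<notin> H\<close> spanning if no proper face of \<open>P\<close> contains \<open>v\<close> and \<open>H\<close>.  A cell that meets
  the interior of \<open>P\<close> is, in exactly one way, the cone with tip \<open>v\<close> over a cell that meets the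
  interior of a spanning face.  As \<open>\<alpha>\<^sup>i(n) - \<alpha>\<^sup>i(n - 1) = \<alpha>\<^bsup>i-1\<^esup>(n)\<close>, the right-hand side has first
  difference \<open>\<Sum>\<^sub>H (-1)\<^bsup>d-1-dim H\<^esup> H(n)\<close> over the spanning faces, by induction on the dimension.
  For \<open>P(n) - P(n - 1)\<close> with \<open>n \<ge> 2\<close>, insert \<open>H(n) = \<Sum>\<^bsub>G \<le> H\<^esub> G(n)\<^sup>\<sharp>\<close> and exchange the sums: it remains to see
  that for every face \<open>G\<close> with \<open>v \<notin> G\<close> the signs of the spanning faces above \<open>G\<close> add up to
  \<open>(-1)\<^bsup>d-1\<^esup>\<close>; the case \<open>G = \<emptyset>\<close> accounts for \<open>P(1) = 1\<close>.  This follows by Moebius-type induction from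
  Euler's relation for intervals \<open>[G, P]\<close> of the face lattice.
\<close>

section \<open>Slicing a polytope by a hyperplane\<close>

text \<open>The exponent is the dimension plus one, so the empty face, of dimension -1, has sign 1
  and \<open>nat\<close> never truncates.\<close>

definition face_sign :: "'a::euclidean_space set \<Rightarrow> int" where
  "face_sign F = (-1) ^ nat (aff_dim F + 1)"

definition crosses :: "'a::euclidean_space \<Rightarrow> real \<Rightarrow> 'a set \<Rightarrow> bool" where
  "crosses a t F \<longleftrightarrow> (\<exists>x\<in>F. a \<bullet> x < t) \<and> (\<exists>y\<in>F. t < a \<bullet> y)"

lemma face_sign_empty [simp]: "face_sign {} = 1"
  by (simp add: face_sign_def)

lemma face_sign_singleton [simp]: "face_sign {v} = -1"
  by (simp add: face_sign_def)

lemma face_sign_square [simp]: "face_sign F * face_sign F = 1"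
  by (simp add: face_sign_def flip: power_add)

lemma finite_faces_of:
  fixes P :: "'a::euclidean_space set"
  shows "polytope P \<Longrightarrow> finite {F. F face_of P \<and> Q F}"
  by (rule finite_subset[OF _ finite_polytope_faces[of P]]) auto

text \<open>A point outside the relative interior lies in a proper face, of smaller dimension;
  descend until this stops.\<close>

lemma polytope_face_rel_interior:
  fixes P :: "'a::euclidean_space set"
  assumes "polytope P" "x \<in> P"
  obtains F where "F face_of P" "x \<in> rel_interior F"
proof -
  have "\<exists>F. F face_of P \<and> x \<in> rel_interior F"
    using assms
  proof (induction "nat (aff_dim P + 1)" arbitrary: P rule: less_induct)
    case less
    show ?case
    proof (cases "x \<in> rel_interior P")
      case True
      then show ?thesis
        using face_of_refl polytope_imp_convex less.prems by blast
    next
      case False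
      then obtain F where F: "F face_of P" "F \<noteq> P" "x \<in> F"
        using less.prems polytope_int_eq_rel_interior[of P] by (auto simp: polytope_int_def)
      moreover have "nat (aff_dim F + 1) < nat (aff_dim P + 1)"
        using F less.prems by (intro face_dim_less) (auto simp: faces_def)
      ultimately obtain E where "E face_of F" "x \<in> rel_interior E"
        using less.hyps less.prems face_of_polytope_polytope by blast
      then show ?thesis using F face_of_trans by blast
    qed
  qed
  then show ?thesis using that by blast
qed

text \<open>Walk from a relative interior point \<open>z\<close> to a point of \<open>F\<close> on
  the other side of the hyperplane: the way there stays in the relative interior and meets the
  hyperplane.\<close>

lemma crosses_imp_rel_interior:
  fixes F :: "'a::euclidean_space set"
  assumes "convex F" "crosses a t F"
  shows "rel_interior F \<inter> {x. a \<bullet> x = t} \<noteq> {}"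
proof -
  obtain x y where xy: "x \<in> F" "a \<bullet> x < t" "y \<in> F" "t < a \<bullet> y"
    using assms(2) by (auto simp: crosses_def)
  then obtain z where z: "z \<in> rel_interior F"
    using assms(1) rel_interior_eq_empty by blast
  \<comment> \<open>The sign condition says that \<open>z\<close> and \<open>w\<close> lie strictly
    on opposite sides; \<open>s\<close> is the parameter at which the segment has height
    \<open>t\<close>.\<close>
  have hit: ?thesis if w: "w \<in> F" and s: "(a \<bullet> z - t) * (t - a \<bullet> w) > 0" for w
  proof -
    define s where "s = (t - a \<bullet> z) / (a \<bullet> w - a \<bullet> z)"
    have ne: "a \<bullet> w \<noteq> a \<bullet> z"
    proof
      assume "a \<bullet> w = a \<bullet> z"
      then show False using s by (auto simp: zero_less_mult_iff)
    qed
    have s01: "0 < s" "s < 1"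
      using s by (auto simp: s_def zero_less_mult_iff zero_less_divide_iff divide_less_eq)
    let ?p = "(1 - s) *\<^sub>R z + s *\<^sub>R w"
    have "?p \<in> open_segment z w"
      using s01 ne by (auto simp: in_segment)
    then have "?p \<in> rel_interior F"
      using rel_interior_closure_convex_segment[OF assms(1) z] w closure_subset by blast
    moreover have "a \<bullet> ?p = t"
    proof -
      have "a \<bullet> ?p = a \<bullet> z + s * (a \<bullet> w - a \<bullet> z)" by (simp add: algebra_simps)
      then show ?thesis using ne by (simp add: s_def)
    qed
    ultimately show ?thesis by blast
  qed
  consider "a \<bullet> z = t" | "a \<bullet> z < t" | "a \<bullet> z > t" by linarith
  then show ?thesis
  proof cases
    case 1 then show ?thesis using z by blast
  next
    case 2 then show ?thesis using hit[of y] xy by (simp add: mult_neg_neg)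
  next
    case 3 then show ?thesis using hit[of x] xy by simp
  qed
qed

text \<open>A segment from a point \<open>w\<close> off the hyperplane can be prolonged inside
  \<open>F\<close> beyond the relative interior point \<open>z\<close>, and its new end is on the
  opposite side.\<close>

lemma rel_interior_imp_crosses:
  fixes F :: "'a::euclidean_space set"
  assumes "convex F" "rel_interior F \<inter> {x. a \<bullet> x = t} \<noteq> {}" "\<not> F \<subseteq> {x. a \<bullet> x = t}"
  shows "crosses a t F"
proof -
  obtain z where z: "z \<in> rel_interior F" "a \<bullet> z = t" using assms(2) by blast
  obtain w where w: "w \<in> F" "a \<bullet> w \<noteq> t" using assms(3) by blast
  obtain e where e: "e > 1" "(1 - e) *\<^sub>R w + e *\<^sub>R z \<in> F"
    using convex_rel_interior_iff[OF assms(1), of z] z(1) w(1) by blast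
  define u where "u = (1 - e) *\<^sub>R w + e *\<^sub>R z"
  have u: "a \<bullet> u - t = (1 - e) * (a \<bullet> w - t)"
    using z by (simp add: u_def algebra_simps)
  have uF: "u \<in> F" using e u_def by simp
  show ?thesis
  proof (cases "a \<bullet> w < t")
    case True
    then have "a \<bullet> u - t > 0" using e by (simp add: u mult_neg_neg)
    then show ?thesis using True w(1) uF by (auto simp: crosses_def)
  next
    case False
    then have "a \<bullet> u - t < 0" using e w by (simp add: u mult_neg_pos)
    moreover have "a \<bullet> w > t" using False w(2) by simp
    ultimately show ?thesis using w(1) uF unfolding crosses_def by force
  qed
qed

text \<open>The slice of the relative interior is nonempty and open in
  \<open>affine hull F \<inter> H\<close>, hence spans it, and a hyperplane not containing an affine
  space it meets cuts its dimension by one.\<close>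

lemma aff_dim_Int_hyperplane_crosses:
  fixes F :: "'a::euclidean_space set"
  assumes "convex F" "crosses a t F"
  shows "aff_dim (F \<inter> {x. a \<bullet> x = t}) = aff_dim F - 1"
proof -
  let ?H = "{x. a \<bullet> x = t}"
  let ?A = "affine hull F \<inter> ?H"
  have A: "affine ?A" by (simp add: affine_Int affine_hyperplane)
  have ne: "?A \<inter> (rel_interior F \<inter> ?H) \<noteq> {}"
    using crosses_imp_rel_interior[OF assms] rel_interior_subset hull_subset[of F affine] by fast
  have "openin (top_of_set ?A) (rel_interior F \<inter> ?H)"
    using openin_rel_interior[of F] by (auto simp: openin_open)
  then have "affine hull (?A \<inter> (rel_interior F \<inter> ?H)) = affine hull ?A"
    using ne A by (intro affine_hull_convex_Int_openin) (simp_all add: affine_imp_convex hull_same)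
  then have "aff_dim ?A = aff_dim (?A \<inter> (rel_interior F \<inter> ?H))"
    by (metis aff_dim_affine_hull)
  also have "\<dots> \<le> aff_dim (F \<inter> ?H)"
    using rel_interior_subset by (intro aff_dim_subset) blast
  finally have "aff_dim ?A \<le> aff_dim (F \<inter> ?H)" .
  moreover have "aff_dim (F \<inter> ?H) \<le> aff_dim ?A"
    using hull_subset[of F affine] by (intro aff_dim_subset) blast
  ultimately have "aff_dim (F \<inter> ?H) = aff_dim ?A" by simp
  also have "\<dots> = aff_dim F - 1"
  proof -
    have "\<not> affine hull F \<subseteq> ?H"
      using assms(2) hull_subset[of F affine] by (fastforce simp: crosses_def)
    then show ?thesis
      using ne by (subst aff_dim_affine_Int_hyperplane) auto
  qed
  finally show ?thesis .
qed

lemma face_sign_slice: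
  fixes F :: "'a::euclidean_space set"
  assumes "convex F" "crosses a t F"
  shows "face_sign (F \<inter> {x. a \<bullet> x = t}) = - face_sign F"
proof -
  have "F \<noteq> {}" using assms(2) by (auto simp: crosses_def)
  then have "aff_dim F \<ge> 0" using aff_dim_geq[of F] aff_dim_empty[of F] by linarith
  then have "nat (aff_dim F + 1) = Suc (nat (aff_dim F - 1 + 1))" by simp
  then show ?thesis
    using aff_dim_Int_hyperplane_crosses[OF assms] by (simp add: face_sign_def)
qed

text \<open>Faces whose relative interiors share a point coincide, which gives injectivity. For
  surjectivity, take a relative interior point of \<open>E\<close> and the face of \<open>P\<close>
  that has it in its relative interior.\<close>

lemma bij_betw_slice:
  fixes P :: "'a::euclidean_space set"
  assumes P: "polytope P" and H: "H = {x. a \<bullet> x = t}"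
  shows "bij_betw (\<lambda>F. F \<inter> H) {F. F face_of P \<and> rel_interior F \<inter> H \<noteq> {}}
           {E. E face_of (P \<inter> H) \<and> E \<noteq> {}}"
  unfolding bij_betw_def
proof
  have aff: "affine H" by (simp add: H affine_hyperplane)
  have conv: "convex F" if "F face_of P" for F
    using that face_of_imp_convex by blast
  have ri: "rel_interior (F \<inter> H) = rel_interior F \<inter> H"
    if "F face_of P" "rel_interior F \<inter> H \<noteq> {}" for F
    using that conv aff convex_affine_rel_interior_Int by blast
  show "inj_on (\<lambda>F. F \<inter> H) {F. F face_of P \<and> rel_interior F \<inter> H \<noteq> {}}"
  proof (rule inj_onI, clarify)
    fix F F'
    assume "F face_of P" "rel_interior F \<inter> H \<noteq> {}" "F' face_of P" "rel_interior F' \<inter> H \<noteq> {}"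
      "F \<inter> H = F' \<inter> H"
    then show "F = F'"
      using ri[of F] ri[of F'] by (intro face_of_eq) auto
  qed
  show "(\<lambda>F. F \<inter> H) ` {F. F face_of P \<and> rel_interior F \<inter> H \<noteq> {}} =
      {E. E face_of (P \<inter> H) \<and> E \<noteq> {}}" (is "?L = ?R")
  proof
    show "?L \<subseteq> ?R"
      using face_of_slice[OF _ affine_imp_convex[OF aff]] rel_interior_subset by fastforce
    show "?R \<subseteq> ?L"
    proof clarify
      fix E assume E: "E face_of (P \<inter> H)" "E \<noteq> {}"
      then obtain x where x: "x \<in> rel_interior E"
        using face_of_imp_convex rel_interior_eq_empty by blast
      then have "x \<in> P" "x \<in> H"
        using E(1) face_of_imp_subset rel_interior_subset by blast+
      then obtain F where F: "F face_of P" "x \<in> rel_interior F"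
        using P polytope_face_rel_interior by blast
      have "E = F \<inter> H"
        using x E(1) F \<open>x \<in> H\<close> ri[OF F(1)]
        by (intro face_of_eq[OF E(1) face_of_slice[OF F(1) affine_imp_convex[OF aff]]]) blast
      then show "E \<in> ?L" using F \<open>x \<in> H\<close> by blast
    qed
  qed
qed

text \<open>A face of the slice comes either from a face inside \<open>H\<close>, with the same
  sign, or from a face crossed by \<open>H\<close>, with the opposite sign.\<close>

lemma sum_face_sign_slice:
  fixes P :: "'a::euclidean_space set"
  assumes P: "polytope P" and H: "H = {x. a \<bullet> x = t}"
    and G: "G face_of P" "G = {} \<or> crosses a t G"
  shows "(\<Sum>E | E face_of (P \<inter> H) \<and> E \<noteq> {} \<and> G \<inter> H \<subseteq> E. face_sign E) =
    (\<Sum>F | F face_of P \<and> F \<noteq> {} \<and> F \<subseteq> H \<and> G \<subseteq> F. face_sign F) -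
    (\<Sum>F | F face_of P \<and> crosses a t F \<and> G \<subseteq> F. face_sign F)"
proof -
  have conv: "convex F" if "F face_of P" for F
    using that face_of_imp_convex by blast
  have riff: "rel_interior F \<inter> H \<noteq> {} \<longleftrightarrow> (F \<noteq> {} \<and> F \<subseteq> H) \<or> crosses a t F" if "F face_of P" for F
    using rel_interior_imp_crosses[OF conv[OF that]] crosses_imp_rel_interior[OF conv[OF that]]
      rel_interior_subset[of F] rel_interior_eq_empty[OF conv[OF that]]
    unfolding H by blast
  have ex: "\<not> (F \<subseteq> H \<and> crosses a t F)" for F
    by (auto simp: H crosses_def)
  \<comment> \<open>A nonempty \<open>G\<close> has a relative interior point on \<open>H\<close>; a
    face containing this point contains \<open>G\<close>.\<close>
  have sub: "G \<inter> H \<subseteq> F \<inter> H \<longleftrightarrow> G \<subseteq> F" if F: "F face_of P" for F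
  proof
    assume L: "G \<inter> H \<subseteq> F \<inter> H"
    show "G \<subseteq> F"
    proof (cases "G = {}")
      case False
      then have "rel_interior G \<inter> H \<noteq> {}" using G riff by blast
      then have "F \<inter> rel_interior G \<noteq> {}" using L rel_interior_subset by fastforce
      then show ?thesis
        using F G(1) by (meson face_of_imp_subset subset_of_face_of)
    qed simp
  qed blast
  let ?S = "{F. F face_of P \<and> rel_interior F \<inter> H \<noteq> {}}"
  have bij: "bij_betw (\<lambda>F. F \<inter> H) ?S {E. E face_of (P \<inter> H) \<and> E \<noteq> {}}"
    by (rule bij_betw_slice[OF P H])
  have "{E. E face_of (P \<inter> H) \<and> E \<noteq> {} \<and> G \<inter> H \<subseteq> E} =
      {E \<in> (\<lambda>F. F \<inter> H) ` ?S. G \<inter> H \<subseteq> E}"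
    unfolding bij_betw_imp_surj_on[OF bij] by blast
  also have "\<dots> = (\<lambda>F. F \<inter> H) ` {F \<in> ?S. G \<subseteq> F}"
    using sub by blast
  finally have "{E. E face_of (P \<inter> H) \<and> E \<noteq> {} \<and> G \<inter> H \<subseteq> E} =
      (\<lambda>F. F \<inter> H) ` {F \<in> ?S. G \<subseteq> F}" .
  moreover have "inj_on (\<lambda>F. F \<inter> H) {F \<in> ?S. G \<subseteq> F}"
    using bij_betw_imp_inj_on[OF bij] by (rule inj_on_subset) auto
  ultimately have "(\<Sum>E | E face_of (P \<inter> H) \<and> E \<noteq> {} \<and> G \<inter> H \<subseteq> E. face_sign E) =
      (\<Sum>F | F \<in> ?S \<and> G \<subseteq> F. face_sign (F \<inter> H))"
    by (simp add: sum.reindex)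
  also have "{F. F \<in> ?S \<and> G \<subseteq> F} = {F. F face_of P \<and> F \<noteq> {} \<and> F \<subseteq> H \<and> G \<subseteq> F} \<union>
      {F. F face_of P \<and> crosses a t F \<and> G \<subseteq> F}"
    using riff by blast
  also have "(\<Sum>F\<in>\<dots>. face_sign (F \<inter> H)) =
      (\<Sum>F | F face_of P \<and> F \<noteq> {} \<and> F \<subseteq> H \<and> G \<subseteq> F. face_sign (F \<inter> H)) +
      (\<Sum>F | F face_of P \<and> crosses a t F \<and> G \<subseteq> F. face_sign (F \<inter> H))"
    using ex by (intro sum.union_disjoint finite_faces_of[OF P]) auto
  also have "(\<Sum>F | F face_of P \<and> F \<noteq> {} \<and> F \<subseteq> H \<and> G \<subseteq> F. face_sign (F \<inter> H)) =
      (\<Sum>F | F face_of P \<and> F \<noteq> {} \<and> F \<subseteq> H \<and> G \<subseteq> F. face_sign F)"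
    by (intro sum.cong) (auto simp: Int_absorb2)
  also have "(\<Sum>F | F face_of P \<and> crosses a t F \<and> G \<subseteq> F. face_sign (F \<inter> H)) =
      - (\<Sum>F | F face_of P \<and> crosses a t F \<and> G \<subseteq> F. face_sign F)"
    unfolding sum_negf[symmetric]
    by (intro sum.cong refl) (auto simp: H face_sign_slice conv)
  finally show ?thesis by simp
qed

section \<open>Vertices in half-spaces and generic directions\<close>

lemma polytope_extreme_point_gt:
  fixes F :: "'a::euclidean_space set"
  assumes "polytope F" "y \<in> F" "s < a \<bullet> y"
  obtains u where "u extreme_point_of F" "s < a \<bullet> u"
proof -
  have "\<not> {u. u extreme_point_of F} \<subseteq> {x. a \<bullet> x \<le> s}"
  proof
    assume "{u. u extreme_point_of F} \<subseteq> {x. a \<bullet> x \<le> s}"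
    then have "convex hull {u. u extreme_point_of F} \<subseteq> {x. a \<bullet> x \<le> s}"
      by (intro hull_minimal) (auto simp: convex_halfspace_le)
    then show False
      using assms Krein_Milman_Minkowski[of F] polytope_imp_compact polytope_imp_convex by force
  qed
  then show ?thesis using that by force
qed

text \<open>The bad directions form a finite union of hyperplanes orthogonal to differences
  \<open>v - w\<close>, a set of measure zero.\<close>

lemma ex_generic:
  fixes V :: "'a::euclidean_space set"
  assumes "finite V"
  shows "\<exists>a. inj_on (\<lambda>v. a \<bullet> v) V"
proof -
  let ?U = "\<Union>p\<in>{(v, w). v \<in> V \<and> w \<in> V \<and> v \<noteq> w}. {a. (fst p - snd p) \<bullet> a = 0}"
  have "finite {(v, w). v \<in> V \<and> w \<in> V \<and> v \<noteq> w}"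
    by (rule finite_subset[OF _ finite_cartesian_product[OF assms assms]]) auto
  then have "negligible ?U"
    by (intro negligible_Union) (auto intro!: negligible_hyperplane)
  then have "?U \<noteq> UNIV" using non_negligible_UNIV by auto
  then obtain a where "a \<notin> ?U" by blast
  then show ?thesis
    by (intro exI[of _ a] inj_onI) (auto simp: inner_diff_left inner_diff_right inner_commute)
qed

section \<open>Euler's relation\<close>

lemma finite_vertices: "polytope P \<Longrightarrow> finite {v. v extreme_point_of P}"
  for P :: "'a::euclidean_space set"
  using finite_polyhedron_extreme_points polytope_imp_polyhedron by blast

lemma polytope_hull_vertices: "polytope P \<Longrightarrow> P = convex hull {v. v extreme_point_of P}"
  for P :: "'a::euclidean_space set"
  using Krein_Milman_Minkowski polytope_imp_compact polytope_imp_convex by blast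

lemma polytope_unique_vertex:
  fixes P :: "'a::euclidean_space set"
  assumes "polytope P" "P \<noteq> {}" "\<And>u. u extreme_point_of P \<Longrightarrow> u = v"
  shows "P = {v}"
proof -
  have "{u. u extreme_point_of P} \<subseteq> {v}" using assms(3) by blast
  then have "{u. u extreme_point_of P} = {} \<or> {u. u extreme_point_of P} = {v}" by blast
  then show ?thesis using polytope_hull_vertices[OF assms(1)] assms(2) by force
qed

lemma polytope_hyperplane_slice:
  fixes P :: "'a::euclidean_space set"
  assumes "polytope P" shows "polytope (P \<inter> {x. a \<bullet> x = t})"
  using assms by (simp add: polytope_Int_polyhedron polyhedron_hyperplane)

text \<open>Provides the decreasing measure for inductions that pass to a slice, be it empty or
  not.\<close>

lemma nat_aff_dim_slice_less:
  fixes P :: "'a::euclidean_space set"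
  assumes "polytope P" "x \<in> P" "a \<bullet> x \<noteq> t"
  shows "nat (aff_dim (P \<inter> {x. a \<bullet> x = t}) + 1) < nat (aff_dim P + 1)"
proof -
  have "aff_dim (P \<inter> {x. a \<bullet> x = t}) < aff_dim P"
  proof (cases "P \<inter> {x. a \<bullet> x = t} = {}")
    case True
    have "aff_dim P \<noteq> -1" using assms(2) aff_dim_empty by blast
    then show ?thesis using True aff_dim_geq[of P] by simp
  next
    case False
    let ?A = "affine hull P \<inter> {x. a \<bullet> x = t}"
    have "P \<inter> {x. a \<bullet> x = t} \<subseteq> ?A" using hull_subset[of P affine] by blast
    then have "aff_dim (P \<inter> {x. a \<bullet> x = t}) \<le> aff_dim ?A" by (rule aff_dim_subset)
    also have "\<dots> = aff_dim P - 1"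
      using False assms hull_subset[of P affine]
      by (subst aff_dim_affine_Int_hyperplane) auto
    finally show ?thesis by simp
  qed
  then show ?thesis using aff_dim_geq[of "P \<inter> {x. a \<bullet> x = t}"] by linarith
qed

text \<open>
  Sweep \<open>P\<close> by a generic hyperplane.  The faces with a given apex \<open>v\<close>, other than \<open>{v}\<close> itself, are
  those crossed just after \<open>v\<close> but not at \<open>v\<close>; by induction both slices satisfy Euler's relation, so
  the faces with apex \<open>v\<close> contribute \<open>0\<close> unless \<open>v\<close> is the last vertex.
\<close>

theorem euler_relation:
  fixes P :: "'a::euclidean_space set"
  assumes "polytope P" "P \<noteq> {}"
  shows "(\<Sum>F | F face_of P. face_sign F) = 0"
  using assms
proof (induction "nat (aff_dim P + 1)" arbitrary: P rule: less_induct)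
  case less
  let ?V = "{v. v extreme_point_of P}"
  have P: "polytope P" by fact
  have finV: "finite ?V" using P by (rule finite_vertices)
  then obtain a where a: "inj_on (\<lambda>v. a \<bullet> v) ?V" using ex_generic by blast
  have gen: "generic_on a F" if "F face_of P" for F
    using a that generic_on_face[of a P] by (auto simp: generic_on_def)
  have poly: "polytope F" if "F face_of P" for F
    using P that face_of_polytope_polytope by blast
  have vertex: "u extreme_point_of P" if "u extreme_point_of F" "F face_of P" for u F
    using that extreme_point_of_face by blast
  have neV: "?V \<noteq> {}" using polytope_hull_vertices[OF P] less.prems(2) by force
  have eqV: "u = w" if "u extreme_point_of P" "w extreme_point_of P" "a \<bullet> u = a \<bullet> w" for u w
    using a that by (auto dest: inj_onD)
  have ap: "apex a F extreme_point_of F" "x \<in> F \<Longrightarrow> a \<bullet> apex a F \<le> a \<bullet> x" "apex a F \<in> F"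
    if "F face_of P" "F \<noteq> {}" for F x
    using apex_extreme_point apex_le apex_in poly gen that by blast+
  let ?A = "\<lambda>v. {F. F face_of P \<and> F \<noteq> {} \<and> apex a F = v}"
  \<comment> \<open>The \<open>- 1\<close> is the sign of \<open>{v}\<close>; all other faces with
    apex \<open>v\<close> rise strictly above it.\<close>
  have split: "(\<Sum>F\<in>?A v. face_sign F) =
      (\<Sum>F | F face_of P \<and> apex a F = v \<and> (\<exists>y\<in>F. a \<bullet> v < a \<bullet> y). face_sign F) - 1"
    if v: "v extreme_point_of P" for v
  proof -
    have vf: "{v} face_of P" using v by (simp add: face_of_singleton)
    have [simp]: "apex a {v} = v" using ap(3)[OF vf] by simp
    have *: "F = {v}" if "F face_of P" "F \<noteq> {}" "apex a F = v" "\<not> (\<exists>y\<in>F. a \<bullet> v < a \<bullet> y)" for F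
    proof (rule polytope_unique_vertex[OF poly])
      fix u assume u: "u extreme_point_of F"
      then have "u \<in> F" by (simp add: extreme_point_of_def)
      then have "a \<bullet> u = a \<bullet> v" using that ap(2)[of F u] by force
      then show "u = v" using eqV vertex u v that(1) by blast
    qed (use that in auto)
    have "?A v = insert {v} {F. F face_of P \<and> apex a F = v \<and> (\<exists>y\<in>F. a \<bullet> v < a \<bullet> y)}"
      (is "_ = insert _ ?B")
    proof (intro equalityI subsetI)
      fix F assume "F \<in> ?A v"
      then show "F \<in> insert {v} ?B" using *[of F] by blast
    next
      fix F assume "F \<in> insert {v} ?B"
      then show "F \<in> ?A v" using vf \<open>apex a {v} = v\<close> by blast
    qed
    moreover have "{v} \<notin> ?B" by simp
    ultimately show ?thesis using finite_faces_of[OF P] by simp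
  qed
  have top: "(\<Sum>F\<in>?A v. face_sign F) = -1"
    if v: "v extreme_point_of P" "\<And>u. u extreme_point_of P \<Longrightarrow> a \<bullet> u \<le> a \<bullet> v" for v
  proof -
    have E: "{F. F face_of P \<and> apex a F = v \<and> (\<exists>y\<in>F. a \<bullet> v < a \<bullet> y)} = {}"
    proof (intro equals0I)
      fix F assume "F \<in> {F. F face_of P \<and> apex a F = v \<and> (\<exists>y\<in>F. a \<bullet> v < a \<bullet> y)}"
      then obtain y where F: "F face_of P" "y \<in> F" "a \<bullet> v < a \<bullet> y" by blast
      then obtain u where "u extreme_point_of F" "a \<bullet> v < a \<bullet> u"
        using polytope_extreme_point_gt[OF poly] by blast
      then show False using v(2)[of u] vertex F(1) by fastforce
    qed
    show ?thesis unfolding split[OF v(1)] E by simp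
  qed
  \<comment> \<open>Euler's relation for the slice by induction; the \<open>1\<close> is its empty
    face.\<close>
  have slice: "(\<Sum>F | F face_of P \<and> F \<noteq> {} \<and> F \<subseteq> {x. a \<bullet> x = t}. face_sign F) + 1 =
      (\<Sum>F | F face_of P \<and> crosses a t F. face_sign F)"
    if "x \<in> P" "a \<bullet> x = t" "w \<in> P" "a \<bullet> w \<noteq> t" for t x w
  proof -
    let ?Q = "P \<inter> {x. a \<bullet> x = t}"
    have Q: "polytope ?Q" "?Q \<noteq> {}" using that polytope_hyperplane_slice[OF P] by blast+
    have "(\<Sum>E | E face_of ?Q. face_sign E) = 0"
      using less.hyps Q nat_aff_dim_slice_less[OF P that(3,4)] by blast
    moreover have "{E. E face_of ?Q} = insert {} {E. E face_of ?Q \<and> E \<noteq> {}}" by auto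
    moreover have "finite {E. E face_of ?Q \<and> E \<noteq> {}}" by (rule finite_faces_of[OF Q(1)])
    ultimately have "(\<Sum>E | E face_of ?Q \<and> E \<noteq> {}. face_sign E) = -1" by simp
    then show ?thesis
      using sum_face_sign_slice[OF P refl empty_face_of, of a t] by simp
  qed
  have mid: "(\<Sum>F\<in>?A v. face_sign F) = 0"
    if v: "v extreme_point_of P" and w: "w extreme_point_of P" "a \<bullet> v < a \<bullet> w" for v w
  proof -
    have vw: "v \<in> P" "w \<in> P" using v w by (auto simp: extreme_point_of_def)
    have vf: "{v} face_of P" using v by (simp add: face_of_singleton)
    \<comment> \<open>\<open>m\<close> is the height of the next vertex above \<open>v\<close>, so
      the hyperplane at \<open>t\<close>, halfway up to it, passes through no vertex and none lies
      between \<open>v\<close> and it.\<close>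
    define m where "m = Min {a \<bullet> u |u. u \<in> ?V \<and> a \<bullet> v < a \<bullet> u}"
    have fin: "finite {a \<bullet> u |u. u \<in> ?V \<and> a \<bullet> v < a \<bullet> u}" using finV by simp
    have ne: "a \<bullet> w \<in> {a \<bullet> u |u. u \<in> ?V \<and> a \<bullet> v < a \<bullet> u}" using w by auto
    have "m \<in> {a \<bullet> u |u. u \<in> ?V \<and> a \<bullet> v < a \<bullet> u}" unfolding m_def using ne fin by (intro Min_in) auto
    then have vm: "a \<bullet> v < m" by auto
    have mle: "m \<le> a \<bullet> u" if "u extreme_point_of P" "a \<bullet> v < a \<bullet> u" for u
      unfolding m_def using that fin by (intro Min_le) auto
    define t where "t = (a \<bullet> v + m) / 2"
    have t: "a \<bullet> v < t" "t < m" using vm by (auto simp: t_def)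
    have gap: "a \<bullet> u \<le> a \<bullet> v \<or> t < a \<bullet> u" if "u extreme_point_of P" for u
      using mle[OF that] t by linarith
    have above: "(\<exists>y\<in>F. t < a \<bullet> y) \<longleftrightarrow> (\<exists>y\<in>F. a \<bullet> v < a \<bullet> y)" if F: "F face_of P" for F
    proof
      assume "\<exists>y\<in>F. a \<bullet> v < a \<bullet> y"
      then obtain u where u: "u extreme_point_of F" "a \<bullet> v < a \<bullet> u"
        using polytope_extreme_point_gt[OF poly[OF F]] by blast
      then have "t < a \<bullet> u" using gap vertex F by force
      then show "\<exists>y\<in>F. t < a \<bullet> y" using u by (auto simp: extreme_point_of_def)
    qed (use t in force)
    have below: "(\<exists>x\<in>F. a \<bullet> x < s) \<longleftrightarrow> a \<bullet> apex a F < s" if F: "F face_of P" "F \<noteq> {}" for F s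
      using ap(2)[OF F] ap(3)[OF F] by force
    have apexP: "apex a F extreme_point_of P" if F: "F face_of P" "F \<noteq> {}" for F
      using ap(1)[OF F] vertex F by blast
    \<comment> \<open>The only nonempty face inside the hyperplane through \<open>v\<close> is
      \<open>{v}\<close>, whose sign -1 cancels the \<open>1\<close> in
      \<open>slice\<close>.\<close>
    have at: "(\<Sum>F | F face_of P \<and> crosses a (a \<bullet> v) F. face_sign F) = 0"
    proof -
      have "F = {v}" if F: "F face_of P" "F \<noteq> {}" "F \<subseteq> {x. a \<bullet> x = a \<bullet> v}" for F
      proof (rule polytope_unique_vertex[OF poly])
        fix u assume u: "u extreme_point_of F"
        then have "a \<bullet> u = a \<bullet> v" using F by (auto simp: extreme_point_of_def)
        then show "u = v" using eqV vertex u v F(1) by blast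
      qed (use F in auto)
      then have V: "{F. F face_of P \<and> F \<noteq> {} \<and> F \<subseteq> {x. a \<bullet> x = a \<bullet> v}} = {{v}}"
        using vf by blast
      have "a \<bullet> w \<noteq> a \<bullet> v" using w by simp
      from slice[OF vw(1) refl vw(2) this] show ?thesis unfolding V by simp
    qed
    \<comment> \<open>No nonempty face lies inside the hyperplane at \<open>t\<close>, since its
      apex would be a vertex of \<open>P\<close> at that height.\<close>
    have after: "(\<Sum>F | F face_of P \<and> crosses a t F. face_sign F) = 1"
    proof -
      have V: "{F. F face_of P \<and> F \<noteq> {} \<and> F \<subseteq> {x. a \<bullet> x = t}} = {}"
      proof (intro equals0I)
        fix F assume "F \<in> {F. F face_of P \<and> F \<noteq> {} \<and> F \<subseteq> {x. a \<bullet> x = t}}"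
        then have F: "F face_of P" "F \<subseteq> {x. a \<bullet> x = t}" "F \<noteq> {}" by blast+
        then have "a \<bullet> apex a F = t" using ap(3) by blast
        then show False using gap[OF apexP[OF F(1,3)]] t by simp
      qed
      obtain x where x: "x \<in> P" "a \<bullet> x = t"
      proof -
        have "crosses a t P" using vw t mle[OF w] by (force simp: crosses_def)
        then show ?thesis
          using that crosses_imp_rel_interior[OF polytope_imp_convex[OF P]] rel_interior_subset by blast
      qed
      have "a \<bullet> v \<noteq> t" using t by simp
      from slice[OF x vw(1) this] show ?thesis unfolding V by simp
    qed
    let ?B = "{F. F face_of P \<and> apex a F = v \<and> (\<exists>y\<in>F. a \<bullet> v < a \<bullet> y)}"
    let ?C = "{F. F face_of P \<and> crosses a (a \<bullet> v) F}"
    \<comment> \<open>A face reaches below \<open>t\<close> iff its apex is below \<open>v\<close>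
      or equal to \<open>v\<close>.\<close>
    have "{F. F face_of P \<and> crosses a t F} = ?B \<union> ?C" (is "?L = ?R")
    proof (intro set_eqI)
      fix F
      show "F \<in> ?L \<longleftrightarrow> F \<in> ?R"
      proof (cases "F face_of P \<and> F \<noteq> {}")
        case True
        then have F: "F face_of P" "F \<noteq> {}" by auto
        have "a \<bullet> apex a F < t \<longleftrightarrow> a \<bullet> apex a F < a \<bullet> v \<or> apex a F = v"
          using gap[OF apexP[OF F]] eqV[OF apexP[OF F] v] t by (metis leD le_less le_less_trans)
        then show ?thesis
          unfolding crosses_def below[OF F] above[OF F(1)] mem_Collect_eq Un_iff
          using F by blast
      qed (auto simp: crosses_def)
    qed
    moreover have "?B \<inter> ?C = {}"
    proof -
      have False if "F \<in> ?B" "F \<in> ?C" for F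
        using that below[of F "a \<bullet> v"] unfolding crosses_def by force
      then show ?thesis by blast
    qed
    ultimately have "(\<Sum>F\<in>?B. face_sign F) = 1"
      using at after finite_faces_of[OF P] by (simp add: sum.union_disjoint)
    then show ?thesis using split[OF v] by simp
  qed
  \<comment> \<open>The class of the highest vertex contributes -1, which cancels the empty face;
    all other classes contribute 0.\<close>
  obtain v where v: "v \<in> ?V" "\<And>u. u \<in> ?V \<Longrightarrow> a \<bullet> u \<le> a \<bullet> v"
  proof -
    have "Max ((\<lambda>u. a \<bullet> u) ` ?V) \<in> (\<lambda>u. a \<bullet> u) ` ?V" using finV neV by (intro Max_in) auto
    then obtain v where "v \<in> ?V" "a \<bullet> v = Max ((\<lambda>u. a \<bullet> u) ` ?V)" by (metis (no_types, lifting) imageE)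
    moreover have "a \<bullet> u \<le> Max ((\<lambda>u. a \<bullet> u) ` ?V)" if "u \<in> ?V" for u
      using finV that by (intro Max_ge) auto
    ultimately show ?thesis using that by metis
  qed
  have "{F. F face_of P} = insert {} {F. F face_of P \<and> F \<noteq> {}}" by auto
  then have "(\<Sum>F | F face_of P. face_sign F) = 1 + (\<Sum>F | F face_of P \<and> F \<noteq> {}. face_sign F)"
    using finite_faces_of[OF P] by simp
  also have "(\<Sum>F | F face_of P \<and> F \<noteq> {}. face_sign F) =
      (\<Sum>u\<in>?V. \<Sum>F | F \<in> {F. F face_of P \<and> F \<noteq> {}} \<and> apex a F = u. face_sign F)"
  proof (intro sum.group[symmetric] finV finite_faces_of[OF P])
    show "apex a ` {F. F face_of P \<and> F \<noteq> {}} \<subseteq> ?V" using ap(1) vertex by blast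
  qed
  also have "\<dots> = (\<Sum>u\<in>?V. \<Sum>F\<in>?A u. face_sign F)" by simp
  also have "\<dots> = (\<Sum>u\<in>?V. if u = v then -1 else 0)"
  proof (intro sum.cong refl)
    fix u assume u: "u \<in> ?V"
    show "(\<Sum>F\<in>?A u. face_sign F) = (if u = v then -1 else 0)"
    proof (cases "u = v")
      case False
      then have "a \<bullet> u < a \<bullet> v" using v eqV u by (metis mem_Collect_eq order_le_less)
      then show ?thesis using False mid[of u v] u v by simp
    next
      case True
      then show ?thesis using top[of v] v by simp
    qed
  qed
  also have "\<dots> = -1" using v(1) finV by simp
  finally show ?case by simp
qed

text \<open>
  The slice near a vertex \<open>v\<close> of \<open>G\<close> that cuts \<open>v\<close> off is a vertex figure: its face lattice is the
  interval \<open>[{v}, P]\<close>, with dimensions lowered by one.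
\<close>

theorem euler_relation_interval:
  fixes P :: "'a::euclidean_space set"
  assumes "polytope P" "G face_of P" "G \<noteq> P"
  shows "(\<Sum>F | F face_of P \<and> G \<subseteq> F. face_sign F) = 0"
  using assms
proof (induction "nat (aff_dim P + 1)" arbitrary: P G rule: less_induct)
  case less
  have P: "polytope P" by fact
  have poly: "polytope F" if "F face_of P" for F
    using P that face_of_polytope_polytope by blast
  have vertex: "u extreme_point_of P" if "u extreme_point_of F" "F face_of P" for u F
    using that extreme_point_of_face by blast
  show ?case
  proof (cases "G = {}")
    case True
    then show ?thesis using euler_relation[OF P] less.prems by simp
  next
    case False
    obtain v where vG: "v extreme_point_of G"
      using polytope_hull_vertices[OF poly[OF less.prems(2)]] False by force
    then have vP: "v extreme_point_of P" using vertex less.prems by blast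
    then have vf: "{v} face_of P" by (simp add: face_of_singleton)
    \<comment> \<open>Faces of polyhedra are exposed, so some linear function attains its maximum
      \<open>b\<close> on \<open>P\<close> only at \<open>v\<close>.\<close>
    then have "{v} exposed_face_of P"
      using exposed_face_of_polyhedron[OF polytope_imp_polyhedron[OF P]] by blast
    then obtain a b where ab: "P \<subseteq> {x. a \<bullet> x \<le> b}" "{v} = P \<inter> {x. a \<bullet> x = b}"
      unfolding exposed_face_of_def by blast
    let ?W = "{v. v extreme_point_of P} - {v}"
    have W: "a \<bullet> w < b" if "w \<in> ?W" for w
      using that ab by (force simp: extreme_point_of_def)
    have finW: "finite ?W" using finite_vertices[OF P] by simp
    \<comment> \<open>The height \<open>t\<close> separates \<open>v\<close> from all other
      vertices; if there are none, any height below \<open>b\<close> serves.\<close>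
    obtain t where t: "t < b" "\<And>w. w \<in> ?W \<Longrightarrow> a \<bullet> w < t"
    proof (cases "?W = {}")
      case True
      then have "\<And>w. w \<in> ?W \<Longrightarrow> a \<bullet> w < b - 1" by blast
      then show ?thesis using that[of "b - 1"] by simp
    next
      case False
      let ?m = "Max ((\<lambda>w. a \<bullet> w) ` ?W)"
      have "?m \<in> (\<lambda>w. a \<bullet> w) ` ?W" using finW False by (intro Max_in) auto
      then have "?m < b" using W by (metis (no_types, lifting) imageE)
      moreover have "a \<bullet> w \<le> ?m" if "w \<in> ?W" for w using finW that by simp
      ultimately show ?thesis using that[of "(?m + b) / 2"] by force
    qed
    let ?H = "{x. a \<bullet> x = t}"
    have vb: "a \<bullet> v = b" "v \<in> P" using ab by auto
    have top: "v \<in> F" if F: "F face_of P" "y \<in> F" "t \<le> a \<bullet> y" for F y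
    proof -
      have "\<exists>u. u extreme_point_of F \<and> t \<le> a \<bullet> u"
      proof (rule ccontr)
        assume "\<not> ?thesis"
        then have "{u. u extreme_point_of F} \<subseteq> {x. a \<bullet> x < t}" by force
        then have "convex hull {u. u extreme_point_of F} \<subseteq> {x. a \<bullet> x < t}"
          by (intro hull_minimal) (auto simp: convex_halfspace_lt)
        then show False using F polytope_hull_vertices[OF poly[OF F(1)]] by force
      qed
      then obtain u where u: "u extreme_point_of F" "t \<le> a \<bullet> u" by blast
      then have "u = v" using t(2)[of u] vertex F(1) by force
      then show ?thesis using u by (simp add: extreme_point_of_def)
    qed
    have cross: "crosses a t F \<longleftrightarrow> v \<in> F \<and> F \<noteq> {v}" if F: "F face_of P" for F
    proof
      assume "crosses a t F"
      then show "v \<in> F \<and> F \<noteq> {v}" using top[OF F] by (force simp: crosses_def)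
    next
      assume vF: "v \<in> F \<and> F \<noteq> {v}"
      then obtain u where "u extreme_point_of F" "u \<noteq> v"
        using polytope_unique_vertex[OF poly[OF F], of v] by blast
      then have "u \<in> F" "a \<bullet> u < t" using t(2) vertex F by (auto simp: extreme_point_of_def)
      then show "crosses a t F" using vF vb t by (auto simp: crosses_def)
    qed
    \<comment> \<open>A face reaching height \<open>t\<close> contains \<open>v\<close>, which is
      strictly higher, so it does not lie inside the hyperplane.\<close>
    have none: "(\<Sum>F | F face_of P \<and> F \<noteq> {} \<and> F \<subseteq> ?H \<and> Q F. face_sign F) = 0" for Q
    proof -
      have "{F. F face_of P \<and> F \<noteq> {} \<and> F \<subseteq> ?H \<and> Q F} = {}"
        using top vb t(1) by force
      then show ?thesis by (simp only: sum.empty)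
    qed
    have "P \<noteq> {v}" using False less.prems face_of_imp_subset[of G P] by blast
    then have crP: "crosses a t P"
      using cross vb face_of_refl polytope_imp_convex[OF P] by blast
    then have riP: "rel_interior P \<inter> ?H \<noteq> {}"
      using crosses_imp_rel_interior polytope_imp_convex[OF P] by blast
    let ?Q = "P \<inter> ?H"
    have Q: "polytope ?Q" "?Q \<noteq> {}"
      using polytope_hyperplane_slice[OF P] riP rel_interior_subset by blast+
    have dim: "nat (aff_dim ?Q + 1) < nat (aff_dim P + 1)"
      by (intro nat_aff_dim_slice_less[OF P vb(2)]) (use vb t in simp)
    have fin: "finite {F. F face_of P \<and> R F}" for R by (rule finite_faces_of[OF P])
    show ?thesis
    proof (cases "G = {v}")
      case True
      \<comment> \<open>The empty face of the vertex figure plays the part of \<open>{v}\<close>;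
        Euler's relation for the whole slice suffices.\<close>
      have "{E. E face_of ?Q} = insert {} {E. E face_of ?Q \<and> E \<noteq> {}}" by auto
      then have "(\<Sum>E | E face_of ?Q \<and> E \<noteq> {}. face_sign E) = -1"
        using euler_relation[OF Q] finite_faces_of[OF Q(1)] by simp
      then have "(\<Sum>F | F face_of P \<and> crosses a t F. face_sign F) = 1"
        using sum_face_sign_slice[OF P refl empty_face_of, of a t] none[of "\<lambda>F. {} \<subseteq> F"] by simp
      moreover have "{F. F face_of P \<and> G \<subseteq> F} = insert {v} {F. F face_of P \<and> crosses a t F}"
        using cross vf True by blast
      moreover have "{v} \<notin> {F. F face_of P \<and> crosses a t F}" using cross by blast
      ultimately show ?thesis using fin by simp
    next
      case ne: False
      have vG': "v \<in> G" using vG by (simp add: extreme_point_of_def)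
      then have crG: "crosses a t G" using ne cross less.prems(2) by blast
      then have riG: "rel_interior G \<inter> ?H \<noteq> {}"
        using crosses_imp_rel_interior face_of_imp_convex less.prems(2) by blast
      have "G \<inter> ?H face_of ?Q"
        using less.prems(2) by (intro face_of_slice convex_hyperplane)
      \<comment> \<open>Otherwise \<open>G\<close> would contain a relative interior point of
        \<open>P\<close>, hence all of \<open>P\<close>.\<close>
      moreover have "G \<inter> ?H \<noteq> ?Q"
      proof
        assume "G \<inter> ?H = ?Q"
        then have "G \<inter> rel_interior P \<noteq> {}" using riP rel_interior_subset by blast
        then have "P \<subseteq> G" using less.prems(2) subset_of_face_of by blast
        then show False using less.prems face_of_imp_subset by blast
      qed
      ultimately have "(\<Sum>E | E face_of ?Q \<and> G \<inter> ?H \<subseteq> E. face_sign E) = 0"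
        using less.hyps[OF dim Q(1)] by blast
      moreover have "{E. E face_of ?Q \<and> G \<inter> ?H \<subseteq> E} =
          {E. E face_of ?Q \<and> E \<noteq> {} \<and> G \<inter> ?H \<subseteq> E}"
        using riG rel_interior_subset by blast
      moreover have "{F. F face_of P \<and> crosses a t F \<and> G \<subseteq> F} = {F. F face_of P \<and> G \<subseteq> F}"
      proof -
        have "crosses a t F" if "G \<subseteq> F" for F using crG that by (auto simp: crosses_def)
        then show ?thesis by blast
      qed
      ultimately show ?thesis
        using sum_face_sign_slice[OF P refl less.prems(2), of a t] crG none[of "\<lambda>F. G \<subseteq> F"] by simp
    qed
  qed
qed

section \<open>Spanning faces\<close>

definition spanning_faces :: "'a::euclidean_space \<Rightarrow> 'a set \<Rightarrow> 'a set set" where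
  "spanning_faces v P =
     {H. H face_of P \<and> v \<notin> H \<and> (\<forall>F. F face_of P \<and> v \<in> F \<and> H \<subseteq> F \<longrightarrow> F = P)}"

text \<open>
  Every face \<open>H\<close> with \<open>v \<notin> H\<close> is spanning in exactly one face of \<open>P\<close>, the smallest one that contains
  \<open>v\<close> and \<open>H\<close> (called \<open>g H\<close> in the proof).
\<close>

lemma sum_face_sign_spanning_faces:
  fixes P :: "'a::euclidean_space set"
  assumes "polytope P" "v \<in> P" "G face_of P" "v \<notin> G"
  shows "(\<Sum>H | H \<in> spanning_faces v P \<and> G \<subseteq> H. face_sign H) = - face_sign P"
  using assms
proof (induction "nat (aff_dim P + 1)" arbitrary: P rule: less_induct)
  case less
  have P: "polytope P" by fact
  have Pf: "P face_of P" using P by (simp add: face_of_refl polytope_imp_convex)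
  define A where "A = {H. H face_of P \<and> v \<notin> H \<and> G \<subseteq> H}"
  define B where "B = {Q. Q face_of P \<and> v \<in> Q \<and> G \<subseteq> Q}"
  define g where "g H = \<Inter>{F. F face_of P \<and> v \<in> F \<and> H \<subseteq> F}" for H
  have fin: "finite A" "finite B"
    unfolding A_def B_def by (rule finite_faces_of[OF P])+
  have PB: "P \<in> B" using Pf less.prems face_of_imp_subset by (auto simp: B_def)
  have g: "g H face_of P" "v \<in> g H" "H \<subseteq> g H" if "H face_of P" for H
  proof -
    have "P \<in> {F. F face_of P \<and> v \<in> F \<and> H \<subseteq> F}"
      using Pf less.prems face_of_imp_subset[OF that] by blast
    then show "g H face_of P" unfolding g_def by (intro face_of_Inter) auto
  qed (auto simp: g_def)
  \<comment> \<open>Faces of \<open>Q\<close> are exactly the faces of \<open>P\<close> inside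
    \<open>Q\<close>, so minimality of \<open>Q\<close> among the faces of \<open>P\<close> above
    \<open>v\<close> and \<open>H\<close> means that \<open>H\<close> is spanning in
    \<open>Q\<close>.\<close>
  have fiber: "{H \<in> A. g H = Q} = {H. H \<in> spanning_faces v Q \<and> G \<subseteq> H}" if Q: "Q \<in> B" for Q
  proof (intro equalityI subsetI)
    fix H assume "H \<in> {H \<in> A. g H = Q}"
    then have H: "H face_of P" "v \<notin> H" "G \<subseteq> H" "g H = Q" by (auto simp: A_def)
    have "F = Q" if F: "F face_of Q" "v \<in> F" "H \<subseteq> F" for F
    proof -
      have "F face_of P" using F Q face_of_trans by (auto simp: B_def)
      then have "g H \<subseteq> F" using F by (auto simp: g_def)
      then show ?thesis using H F face_of_imp_subset by blast
    qed
    moreover have "H face_of Q"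
      using H g[OF H(1)] face_of_face[of Q P H] by blast
    ultimately show "H \<in> {H. H \<in> spanning_faces v Q \<and> G \<subseteq> H}"
      using H by (auto simp: spanning_faces_def)
  next
    fix H assume "H \<in> {H. H \<in> spanning_faces v Q \<and> G \<subseteq> H}"
    then have H: "H face_of Q" "v \<notin> H" "G \<subseteq> H"
      and span: "\<And>F. F face_of Q \<Longrightarrow> v \<in> F \<Longrightarrow> H \<subseteq> F \<Longrightarrow> F = Q"
      by (auto simp: spanning_faces_def)
    have QP: "Q face_of P" "v \<in> Q" using Q by (auto simp: B_def)
    then have HP: "H face_of P" using H face_of_trans by blast
    have "g H \<subseteq> Q" using QP face_of_imp_subset[OF H(1)] by (auto simp: g_def)
    then have "g H face_of Q" using g[OF HP] QP face_of_face by blast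
    then have "g H = Q" using span g[OF HP] by blast
    then show "H \<in> {H \<in> A. g H = Q}" using H HP by (auto simp: A_def)
  qed
  \<comment> \<open>Euler's relation for the interval \<open>[G, P]\<close>, split by whether a face
    contains \<open>v\<close>.\<close>
  have "(\<Sum>H\<in>A. face_sign H) + (\<Sum>Q\<in>B. face_sign Q) = 0"
  proof -
    have "{F. F face_of P \<and> G \<subseteq> F} = A \<union> B" "A \<inter> B = {}" by (auto simp: A_def B_def)
    moreover have "G \<noteq> P" using less.prems by blast
    ultimately show ?thesis
      using euler_relation_interval[OF P less.prems(3)] fin by (simp add: sum.union_disjoint)
  qed
  moreover have "(\<Sum>H\<in>A. face_sign H) = (\<Sum>Q\<in>B. \<Sum>H | H \<in> A \<and> g H = Q. face_sign H)"
  proof (intro sum.group[symmetric] fin)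
    show "g ` A \<subseteq> B" using g unfolding A_def B_def by blast
  qed
  moreover have "\<dots> = (\<Sum>Q\<in>B. \<Sum>H | H \<in> spanning_faces v Q \<and> G \<subseteq> H. face_sign H)"
    using fiber by (intro sum.cong) auto
  moreover have "\<dots> = (\<Sum>H | H \<in> spanning_faces v P \<and> G \<subseteq> H. face_sign H) +
      (\<Sum>Q\<in>B - {P}. \<Sum>H | H \<in> spanning_faces v Q \<and> G \<subseteq> H. face_sign H)"
    using fin PB by (simp add: sum.remove)
  \<comment> \<open>By induction each proper \<open>Q\<close> contributes
    \<open>- face_sign Q\<close> to the sum over \<open>A\<close>, cancelling its term in the sum
    over \<open>B\<close>; only the terms of \<open>P\<close> remain.\<close>
  moreover have "(\<Sum>Q\<in>B - {P}. \<Sum>H | H \<in> spanning_faces v Q \<and> G \<subseteq> H. face_sign H) =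
      (\<Sum>Q\<in>B - {P}. - face_sign Q)"
  proof (intro sum.cong refl)
    fix Q assume "Q \<in> B - {P}"
    then have Q: "Q face_of P" "v \<in> Q" "G \<subseteq> Q" "Q \<noteq> P" by (auto simp: B_def)
    have "nat (aff_dim Q + 1) < nat (aff_dim P + 1)"
      using Q by (intro face_dim_less[OF P]) (auto simp: faces_def)
    moreover have "G face_of Q" using Q less.prems face_of_face by blast
    ultimately show "(\<Sum>H | H \<in> spanning_faces v Q \<and> G \<subseteq> H. face_sign H) = - face_sign Q"
      using less.hyps Q less.prems face_of_polytope_polytope by blast
  qed
  moreover have "(\<Sum>Q\<in>B. face_sign Q) = face_sign P + (\<Sum>Q\<in>B - {P}. face_sign Q)"
    using fin PB by (simp add: sum.remove)
  ultimately show ?case by (simp add: sum_negf)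
qed

section \<open>Interior cells as cones over interior cells of spanning faces\<close>

definition pointed_chain :: "'a::euclidean_space \<Rightarrow> 'a set \<Rightarrow> 'a set list \<Rightarrow> bool" where
  "pointed_chain c P Gs \<longleftrightarrow> Gs \<noteq> [] \<and> set Gs \<subseteq> faces P \<and>
     successively (\<lambda>G H. H \<subset> G \<and> apex c G \<notin> H) Gs"

lemma pointed_chain_Cons:
  "pointed_chain c P (G # Gs) \<longleftrightarrow> G \<in> faces P \<and>
     (Gs = [] \<or> pointed_chain c P Gs \<and> hd Gs \<subset> G \<and> apex c G \<notin> hd Gs)"
  by (cases Gs) (auto simp: pointed_chain_def)

lemma pointed_chain_subset_hd:
  assumes "pointed_chain c P Gs" "H \<in> set Gs"
  shows "H \<subseteq> hd Gs"
  using assms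
proof (induction Gs)
  case (Cons G Gs)
  then show ?case by (cases "Gs = []") (auto simp: pointed_chain_Cons)
qed simp

lemma pointed_chain_hd: "pointed_chain c P Gs \<Longrightarrow> hd Gs \<in> faces P"
  by (auto simp: pointed_chain_def)

text \<open>Each step passes to a proper face, so the dimension drops strictly along the chain while
  staying at least 0.\<close>

lemma length_pointed_chain:
  assumes "polytope P" "pointed_chain c P Gs"
  shows "int (length Gs) \<le> aff_dim (hd Gs) + 1"
  using assms(2)
proof (induction Gs)
  case (Cons G Gs)
  have G: "G face_of P" "G \<noteq> {}" using Cons.prems by (auto simp: pointed_chain_Cons faces_def)
  then have "aff_dim G \<ge> 0" using aff_dim_geq[of G] aff_dim_empty[of G] by linarith
  show ?case
  proof (cases "Gs = []")
    case False
    then have *: "pointed_chain c P Gs" "hd Gs \<subset> G"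
      using Cons.prems by (auto simp: pointed_chain_Cons)
    then have "hd Gs face_of G"
      using G pointed_chain_hd[OF *(1)] by (auto simp: faces_def face_of_face)
    then have "aff_dim (hd Gs) < aff_dim G"
      using * G by (intro face_of_aff_dim_lt) (auto intro: face_of_imp_convex)
    then show ?thesis using Cons.IH[OF *(1)] by simp
  qed (use \<open>aff_dim G \<ge> 0\<close> in simp)
qed (simp add: pointed_chain_def)

lemma pointed_triangulation_iff:
  assumes "polytope P"
  shows "S \<in> pointed_triangulation c P \<longleftrightarrow>
    S = {} \<or> (\<exists>Gs. pointed_chain c P Gs \<and> S = convex hull (apex c ` set Gs))"
proof -
  have "int (length Gs) \<le> aff_dim P + 1" if "pointed_chain c P Gs" for Gs
  proof -
    have "hd Gs \<subseteq> P"
      using pointed_chain_hd[OF that] face_of_imp_subset by (auto simp: faces_def)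
    then have "aff_dim (hd Gs) \<le> aff_dim P" by (rule aff_dim_subset)
    then show ?thesis using length_pointed_chain[OF assms that] by simp
  qed
  then show ?thesis
    unfolding pointed_triangulation_def pointed_chain_def
    by (auto simp: Suc_le_eq)
qed

lemma convex_hull_insert_hull:
  "convex hull (insert v (convex hull W)) = convex hull (insert v W)"
  by (metis hull_insert)

text \<open>These assumptions pass to all nonempty faces, so results proved here can be instantiated
  at spanning faces during inductions on the dimension.\<close>

locale generic_polytope =
  fixes P :: "'a::euclidean_space set" and c :: 'a
  assumes polytope: "polytope P" and nonempty: "P \<noteq> {}" and generic: "generic_on c P"
begin

lemma apex_face:
  assumes "F \<in> faces P"
  shows "apex c F extreme_point_of F" "x \<in> F \<Longrightarrow> c \<bullet> apex c F \<le> c \<bullet> x" "apex c F \<in> F"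
  using facesD[OF assms polytope] generic_on_face[OF generic]
    apex_extreme_point apex_le apex_in by blast+

lemma P_face: "P \<in> faces P"
  using polytope nonempty by (simp add: faces_def face_of_refl polytope_imp_convex)

lemma generic_polytope_face: "F \<in> faces P \<Longrightarrow> generic_polytope F c"
  using facesD[OF _ polytope] generic_on_face[OF generic] by unfold_locales blast+

lemma cell_subset_hd:
  assumes "pointed_chain c P Gs"
  shows "convex hull (apex c ` set Gs) \<subseteq> hd Gs"
proof (rule hull_minimal)
  have "set Gs \<subseteq> faces P" using assms by (simp add: pointed_chain_def)
  then show "apex c ` set Gs \<subseteq> hd Gs"
    using pointed_chain_subset_hd[OF assms] apex_face(3) by blast
  show "convex (hd Gs)"
    using pointed_chain_hd[OF assms] face_of_imp_convex by (auto simp: faces_def)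
qed

lemma notin_affine_hull_face:
  assumes "F face_of P" "x \<in> P" "x \<notin> F"
  shows "x \<notin> affine hull F"
  using face_of_imp_eq_affine_Int[OF polytope_imp_convex[OF polytope] assms(1)] assms by blast

text \<open>All later apexes lie in the next face of the chain, and the apex in front is outside the
  affine hull of that face.\<close>

lemma affine_independent_apexes:
  assumes "pointed_chain c P Gs"
  shows "\<not> affine_dependent (apex c ` set Gs)"
  using assms
proof (induction Gs)
  case (Cons G Gs)
  show ?case
  proof (cases "Gs = []")
    case False
    then have *: "pointed_chain c P Gs" "apex c G \<notin> hd Gs" "G \<in> faces P"
      using Cons.prems by (auto simp: pointed_chain_Cons)
    have "apex c ` set Gs \<subseteq> hd Gs"
      using cell_subset_hd[OF *(1)] hull_subset[of "apex c ` set Gs" convex] by (rule subset_trans[rotated])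
    then have "affine hull (apex c ` set Gs) \<subseteq> affine hull (hd Gs)" by (rule hull_mono)
    moreover have "apex c G \<notin> affine hull (hd Gs)"
    proof (rule notin_affine_hull_face)
      show "hd Gs face_of P" using pointed_chain_hd[OF *(1)] by (simp add: faces_def)
      have "G \<subseteq> P" using *(3) face_of_imp_subset by (auto simp: faces_def)
      then show "apex c G \<in> P" using apex_face(3)[OF *(3)] by blast
    qed (rule *(2))
    ultimately show ?thesis
      using affine_independent_insert[OF Cons.IH[OF *(1)], of "apex c G"] by auto
  qed simp
qed simp

section \<open>Cells that meet the interior\<close>

definition interior_cells :: "'a set set" where
  "interior_cells = {S \<in> pointed_triangulation c P. S \<inter> rel_interior P \<noteq> {}}"

lemma in_face_rel_interior:
  assumes "F face_of P" "x \<in> F" "x \<in> rel_interior P"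
  shows "F = P"
  using assms face_of_disjoint_rel_interior by blast

text \<open>A cell lies in the first face of its chain, and a face that meets the relative interior
  of \<open>P\<close> is \<open>P\<close>.\<close>

lemma interior_cells_iff:
  "S \<in> interior_cells \<longleftrightarrow> (\<exists>Gs. pointed_chain c P Gs \<and> hd Gs = P \<and>
     S = convex hull (apex c ` set Gs) \<and> S \<inter> rel_interior P \<noteq> {})" (is "?L \<longleftrightarrow> ?R")
proof
  assume ?L
  then obtain Gs where Gs: "pointed_chain c P Gs" "S = convex hull (apex c ` set Gs)"
    "S \<inter> rel_interior P \<noteq> {}"
    by (auto simp: interior_cells_def pointed_triangulation_iff[OF polytope])
  moreover have "hd Gs = P"
    using Gs cell_subset_hd[OF Gs(1)] pointed_chain_hd[OF Gs(1)] in_face_rel_interior[of "hd Gs"]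
    by (auto simp: faces_def)
  ultimately show ?R by blast
qed (auto simp: interior_cells_def pointed_triangulation_iff[OF polytope])

lemma interior_cell_subset: "S \<in> interior_cells \<Longrightarrow> S \<subseteq> P"
  using cell_subset_hd by (auto simp: interior_cells_iff)

text \<open>Cells are simplexes by affine independence, and the chain of an interior cell starts
  with \<open>P\<close>, so the apex of \<open>P\<close> is among its vertices.\<close>

lemma interior_apex_simplexes_eq:
  "interior_apex_simplexes c P i = {S \<in> interior_cells. aff_dim S = int i}"
proof (intro equalityI subsetI)
  fix S assume "S \<in> interior_apex_simplexes c P i"
  then show "S \<in> {S \<in> interior_cells. aff_dim S = int i}"
    by (auto simp: interior_apex_simplexes_def interior_cells_def aff_dim_simplex
        polytope_int_eq_rel_interior[OF polytope])
next
  fix S assume S: "S \<in> {S \<in> interior_cells. aff_dim S = int i}"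
  then obtain Gs where Gs: "pointed_chain c P Gs" "hd Gs = P" "S = convex hull (apex c ` set Gs)"
    by (auto simp: interior_cells_iff)
  have "int i simplex S"
    unfolding simplex_def
  proof (intro exI conjI)
    show "\<not> affine_dependent (apex c ` set Gs)" by (rule affine_independent_apexes[OF Gs(1)])
    then show "int (card (apex c ` set Gs)) = int i + 1"
      using S Gs(3) aff_dim_affine_independent by (fastforce simp: aff_dim_convex_hull)
  qed (rule Gs(3))
  moreover have "apex c P \<in> S"
    using Gs by (auto simp: pointed_chain_def intro!: hull_inc)
  ultimately show "S \<in> interior_apex_simplexes c P i"
    using S by (auto simp: interior_apex_simplexes_def interior_cells_def
        polytope_int_eq_rel_interior[OF polytope])
qed

abbreviation spanning :: "'a set set" where
  "spanning \<equiv> spanning_faces (apex c P) P"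

lemma apex_in_P: "apex c P \<in> P"
  using apex_face(3)[OF P_face] .

text \<open>In positive dimension the vertex \<open>{apex c P}\<close> is a proper face above the
  empty one, so the empty face is not spanning.\<close>

lemma spanning_faces_nonempty:
  assumes "aff_dim P \<ge> 1" "H \<in> spanning"
  shows "H \<in> faces P"
proof -
  have "{apex c P} face_of P"
    using apex_face(1)[OF P_face] by (simp add: face_of_singleton)
  moreover have "{apex c P} \<noteq> P" using assms(1) by (metis aff_dim_sing not_one_le_zero)
  ultimately show ?thesis using assms(2) by (auto simp: spanning_faces_def faces_def)
qed

lemma cone_interior_cell:
  assumes "aff_dim P \<ge> 1" "H \<in> spanning" "S \<in> generic_polytope.interior_cells H c"
  shows "convex hull (insert (apex c P) S) \<in> interior_cells"
proof -
  have Hf: "H \<in> faces P" using assms spanning_faces_nonempty by blast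
  have H: "H face_of P" "apex c P \<notin> H"
    "\<And>F. F face_of P \<Longrightarrow> apex c P \<in> F \<Longrightarrow> H \<subseteq> F \<Longrightarrow> F = P"
    using assms(2) by (auto simp: spanning_faces_def)
  interpret H: generic_polytope H c by (rule generic_polytope_face[OF Hf])
  obtain Gs where Gs: "pointed_chain c H Gs" "hd Gs = H" "S = convex hull (apex c ` set Gs)"
    "S \<inter> rel_interior H \<noteq> {}"
    using assms(3) by (auto simp: H.interior_cells_iff)
  have "faces H \<subseteq> faces P" using H(1) face_of_trans by (auto simp: faces_def)
  then have "pointed_chain c P Gs" using Gs(1) by (auto simp: pointed_chain_def)
  moreover have "H \<subset> P" using H face_of_imp_subset apex_in_P by blast
  ultimately have chain: "pointed_chain c P (P # Gs)"
    using Gs H P_face by (simp add: pointed_chain_Cons)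
  have hull: "convex hull (insert (apex c P) S) = convex hull (apex c ` set (P # Gs))"
    using Gs(3) by (simp add: convex_hull_insert_hull)
  obtain x where x: "x \<in> S" "x \<in> rel_interior H" using Gs(4) by blast
  have xH: "x \<in> H" using x(2) rel_interior_subset by blast
  \<comment> \<open>The midpoint witnesses that the cone meets the interior: a face containing it
    contains both ends of the segment, hence the apex and all of \<open>H\<close>, and so is
    \<open>P\<close>.\<close>
  let ?m = "midpoint (apex c P) x"
  have ne: "apex c P \<noteq> x" using xH H(2) by blast
  have m: "?m \<in> open_segment (apex c P) x" using ne by simp
  have xP: "x \<in> P" using xH \<open>H \<subset> P\<close> by blast
  have "?m \<in> P"
    using m convex_contains_open_segment polytope_imp_convex[OF polytope] apex_in_P xP by blast
  then obtain F where F: "F face_of P" "?m \<in> rel_interior F"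
    using polytope polytope_face_rel_interior by blast
  then have "?m \<in> F" using rel_interior_subset by blast
  then have "apex c P \<in> F" "x \<in> F" using face_ofD[OF F(1) m apex_in_P xP] by auto
  moreover have "H \<subseteq> F"
    using x(2) \<open>x \<in> F\<close> F(1) \<open>H \<subset> P\<close> by (intro subset_of_face_of[of F P]) auto
  ultimately have "F = P" using H(3) F(1) by blast
  moreover have "?m \<in> convex hull (insert (apex c P) S)"
  proof -
    have "apex c P \<in> convex hull (insert (apex c P) S)" "x \<in> convex hull (insert (apex c P) S)"
      using x(1) by (auto intro: hull_inc)
    then show ?thesis
      using m convex_contains_open_segment convex_convex_hull by blast
  qed
  ultimately show ?thesis
    unfolding interior_cells_iff using chain hull F(2) by (intro exI[of _ "P # Gs"]) auto
qed

text \<open>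
  The chain of a cell is not unique.  The base face \<open>H\<close> is the smallest face that contains the base
  \<open>S'\<close> of the cone, and intersecting the tail of the chain with \<open>H\<close> changes no apex.
\<close>

lemma interior_cell_is_cone:
  assumes "aff_dim P \<ge> 1" "S \<in> interior_cells"
  obtains H S' where "H \<in> spanning" "S' \<in> generic_polytope.interior_cells H c"
    "S = convex hull (insert (apex c P) S')"
proof -
  let ?v = "apex c P"
  obtain Gs where "pointed_chain c P Gs" "hd Gs = P"
    and S: "S = convex hull (apex c ` set Gs)" "S \<inter> rel_interior P \<noteq> {}"
    using assms(2) by (auto simp: interior_cells_iff)
  then obtain Gs' where Gs: "pointed_chain c P (P # Gs')" "Gs = P # Gs'"
    by (cases Gs) (auto simp: pointed_chain_def)
  have vf: "{?v} face_of P" using apex_face(1)[OF P_face] by (simp add: face_of_singleton)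
  have "{?v} \<noteq> P" using assms(1) by (metis aff_dim_sing not_one_le_zero)
  \<comment> \<open>With \<open>P\<close> alone the cell would be the single vertex
    \<open>{?v}\<close>, a proper face that misses the interior.\<close>
  then have "Gs' \<noteq> []"
    using S Gs(2) in_face_rel_interior[OF vf] by auto
  then have Gs': "pointed_chain c P Gs'" "?v \<notin> hd Gs'"
    using Gs(1) by (auto simp: pointed_chain_Cons)
  define S' where "S' = convex hull (apex c ` set Gs')"
  have SS': "S = convex hull (insert ?v S')"
    using S(1) Gs(2) by (simp add: S'_def convex_hull_insert_hull)
  have "S' \<noteq> {}" using \<open>Gs' \<noteq> []\<close> by (simp add: S'_def)
  then obtain x where x: "x \<in> rel_interior S'"
    using rel_interior_eq_empty[of S'] by (auto simp: S'_def)
  have S'hd: "S' \<subseteq> hd Gs'" unfolding S'_def by (rule cell_subset_hd[OF Gs'(1)])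
  have hdP: "hd Gs' face_of P" using pointed_chain_hd[OF Gs'(1)] by (simp add: faces_def)
  have S'P: "S' \<subseteq> P" using S'hd hdP face_of_imp_subset by blast
  have xS': "x \<in> S'" using x rel_interior_subset by blast
  then obtain H where H: "H face_of P" "x \<in> rel_interior H"
    using polytope polytope_face_rel_interior S'P by blast
  have xH: "x \<in> H" using H(2) rel_interior_subset by blast
  have S'H: "S' \<subseteq> H" using H(1) S'P xH x by (intro subset_of_face_of[of H P]) auto
  have "H \<subseteq> hd Gs'"
    using hdP H face_of_imp_subset[OF H(1)] xS' S'hd by (intro subset_of_face_of[of "hd Gs'" P]) auto
  then have vH: "?v \<notin> H" using Gs'(2) by blast
  have Hf: "H \<in> faces P" using H(1) xH by (auto simp: faces_def)
  have "F = P" if F: "F face_of P" "?v \<in> F" "H \<subseteq> F" for F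
  proof -
    have "S \<subseteq> F"
      unfolding SS' using F S'H by (intro hull_minimal face_of_imp_convex[OF F(1)]) auto
    then show ?thesis using S(2) in_face_rel_interior[OF F(1)] by blast
  qed
  then have span: "H \<in> spanning" using H(1) vH by (auto simp: spanning_faces_def)
  interpret H: generic_polytope H c by (rule generic_polytope_face[OF Hf])
  have inH: "apex c G \<in> G \<inter> H" if "G \<in> set Gs'" for G
  proof -
    have "apex c G \<in> S'" unfolding S'_def using that by (intro hull_inc) auto
    moreover have "G \<in> faces P" using that Gs'(1) by (auto simp: pointed_chain_def)
    ultimately show ?thesis using apex_face(3) S'H by blast
  qed
  have face: "G \<inter> H \<in> faces P" if "G \<in> set Gs'" for G
    using that inH[OF that] Gs'(1) H(1) by (auto simp: pointed_chain_def faces_def intro!: face_of_Int)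
  \<comment> \<open>The apex of \<open>G\<close> lies in \<open>G \<inter> H\<close> and is minimal
    even on \<open>G\<close>; genericity makes the two minimal vertices equal.\<close>
  have apex: "apex c (G \<inter> H) = apex c G" if G: "G \<in> set Gs'" for G
  proof -
    have Gf: "G \<in> faces P" using G Gs'(1) by (auto simp: pointed_chain_def)
    let ?w = "apex c (G \<inter> H)"
    have "?w extreme_point_of P" "apex c G extreme_point_of P"
      using apex_face(1)[OF face[OF G]] apex_face(1)[OF Gf] face[OF G] Gf
      by (auto simp: faces_def extreme_point_of_face)
    moreover have "c \<bullet> ?w = c \<bullet> apex c G"
      using apex_face(2)[OF face[OF G] inH[OF G]] apex_face(2)[OF Gf, of ?w]
        apex_face(3)[OF face[OF G]] by auto
    ultimately show ?thesis using generic by (auto simp: generic_on_def dest: inj_onD)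
  qed
  let ?Hs = "map (\<lambda>G. G \<inter> H) Gs'"
  have "pointed_chain c H ?Hs"
    unfolding pointed_chain_def
  proof (intro conjI)
    show "?Hs \<noteq> []" using \<open>Gs' \<noteq> []\<close> by simp
    show "set ?Hs \<subseteq> faces H"
      using face H(1) face_of_face by (fastforce simp: faces_def)
    have "successively (\<lambda>G G'. G' \<subset> G \<and> apex c G \<notin> G') Gs'"
      using Gs'(1) by (simp add: pointed_chain_def)
    \<comment> \<open>Inclusions stay strict because the apex of \<open>G\<close> lies in
      \<open>G \<inter> H\<close> but not in \<open>G'\<close>.\<close>
    then have "successively (\<lambda>G G'. G' \<inter> H \<subset> G \<inter> H \<and> apex c (G \<inter> H) \<notin> G' \<inter> H) Gs'"
      using inH apex by (elim successively_mono) auto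
    then show "successively (\<lambda>G G'. G' \<subset> G \<and> apex c G \<notin> G') ?Hs"
      by (simp add: successively_map)
  qed
  moreover have "convex hull (apex c ` set ?Hs) = S'"
  proof -
    have "apex c ` set ?Hs = apex c ` set Gs'" by (simp add: image_image apex)
    then show ?thesis by (simp only: S'_def)
  qed
  ultimately have "S' \<in> H.interior_cells"
    unfolding H.interior_cells_def pointed_triangulation_iff[OF H.polytope]
    using xS' H(2) by blast
  then show ?thesis using that span SS' by blast
qed

section \<open>Cones over cells and the count of interior cells\<close>

lemma aff_dim_cone:
  assumes "H face_of P" "apex c P \<notin> H" "S \<subseteq> H"
  shows "aff_dim (convex hull (insert (apex c P) S)) = aff_dim S + 1"
proof -
  have "apex c P \<notin> affine hull S"
    using notin_affine_hull_face[OF assms(1) apex_in_P assms(2)] hull_mono[OF assms(3)] by blast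
  then show ?thesis by (simp add: aff_dim_convex_hull aff_dim_insert)
qed

text \<open>The cone is again a simplex, so deleting its tip from its set of vertices leaves the
  vertices of the base.\<close>

lemma cone_base_eq:
  assumes "H face_of P" "apex c P \<notin> H" "S = convex hull W" "S \<subseteq> H" "\<not> affine_dependent W"
  shows "S = convex hull ({x. x extreme_point_of convex hull (insert (apex c P) S)} - {apex c P})"
proof -
  have WH: "W \<subseteq> H" using assms(3,4) hull_subset[of W convex] by simp
  have "apex c P \<notin> affine hull W"
    using notin_affine_hull_face[OF assms(1) apex_in_P assms(2)] hull_mono[OF WH] by blast
  then have "\<not> affine_dependent (insert (apex c P) W)"
    using assms(5) by (rule affine_independent_insert[rotated])
  then have "{x. x extreme_point_of convex hull (insert (apex c P) W)} = insert (apex c P) W"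
    using extreme_point_of_convex_hull_affine_independent by blast
  moreover have "apex c P \<notin> W" using WH assms(2) by blast
  ultimately show ?thesis by (simp add: assms(3) convex_hull_insert_hull)
qed

text \<open>Taking cones is a bijection from pairs of a spanning face and an interior cell of it,
  and raises the dimension by one.\<close>

lemma card_interior_apex_simplexes_Suc:
  assumes "aff_dim P \<ge> 1"
  shows "card (interior_apex_simplexes c P (Suc j)) =
    (\<Sum>H\<in>spanning. card (interior_apex_simplexes c H j))"
proof -
  let ?v = "apex c P"
  let ?I = "\<lambda>H. interior_apex_simplexes c H j"
  let ?f = "\<lambda>(H, S). convex hull (insert ?v S)"
  have eq: "?I H = {S \<in> generic_polytope.interior_cells H c. aff_dim S = int j}" if "H \<in> spanning" for H
    using generic_polytope.interior_apex_simplexes_eq generic_polytope_face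
      spanning_faces_nonempty[OF assms that] by blast
  have sub: "S \<subseteq> H" if "H \<in> spanning" "S \<in> generic_polytope.interior_cells H c" for H S
    using generic_polytope.interior_cell_subset generic_polytope_face
      spanning_faces_nonempty[OF assms] that by blast
  have dim: "aff_dim (convex hull (insert ?v S)) = aff_dim S + 1"
    if "H \<in> spanning" "S \<in> generic_polytope.interior_cells H c" for H S
    using that sub[OF that] by (intro aff_dim_cone[of H]) (auto simp: spanning_faces_def)
  have "interior_apex_simplexes c P (Suc j) = ?f ` (SIGMA H:spanning. ?I H)"
  proof (intro equalityI subsetI)
    fix S assume "S \<in> interior_apex_simplexes c P (Suc j)"
    then have S: "S \<in> interior_cells" "aff_dim S = int (Suc j)"
      by (auto simp: interior_apex_simplexes_eq)
    obtain H S' where HS: "H \<in> spanning" "S' \<in> generic_polytope.interior_cells H c"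
      "S = convex hull (insert ?v S')"
      using interior_cell_is_cone[OF assms S(1)] by blast
    then have "S' \<in> ?I H" using eq dim S(2) by auto
    then show "S \<in> ?f ` (SIGMA H:spanning. ?I H)" using HS by force
  next
    fix S assume "S \<in> ?f ` (SIGMA H:spanning. ?I H)"
    then obtain H S' where HS: "H \<in> spanning" "S' \<in> ?I H" "S = convex hull (insert ?v S')" by auto
    then have "S' \<in> generic_polytope.interior_cells H c" "aff_dim S' = int j" using eq by auto
    then show "S \<in> interior_apex_simplexes c P (Suc j)"
      using HS cone_interior_cell[OF assms HS(1)] dim[OF HS(1)]
      by (auto simp: interior_apex_simplexes_eq)
  qed
  moreover have "inj_on ?f (SIGMA H:spanning. ?I H)"
  proof -
    have rec: "S = convex hull ({x. x extreme_point_of convex hull (insert ?v S)} - {?v})"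
      if HS: "H \<in> spanning" "S \<in> generic_polytope.interior_cells H c" for H S
    proof -
      have g: "generic_polytope H c"
        using generic_polytope_face spanning_faces_nonempty[OF assms HS(1)] by blast
      then obtain Gs where "pointed_chain c H Gs" "S = convex hull (apex c ` set Gs)"
        using HS(2) by (auto simp: generic_polytope.interior_cells_iff)
      then show ?thesis
        using HS sub[OF HS] generic_polytope.affine_independent_apexes[OF g]
        by (intro cone_base_eq[of H _ "apex c ` set Gs"]) (auto simp: spanning_faces_def)
    qed
    \<comment> \<open>\<open>H\<close> is determined by \<open>S\<close>: a relative interior point
      of \<open>H\<close> in \<open>S\<close> also lies in \<open>H'\<close>, which forces
      \<open>H \<subseteq> H'\<close>, and the roles can be exchanged.\<close>
    have same: "H \<subseteq> H'"
      if HS: "H \<in> spanning" "S \<in> generic_polytope.interior_cells H c"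
        "H' \<in> spanning" "S \<in> generic_polytope.interior_cells H' c" for H H' S
    proof -
      have g: "generic_polytope H c"
        using generic_polytope_face spanning_faces_nonempty[OF assms HS(1)] by blast
      obtain x where x: "x \<in> S" "x \<in> rel_interior H"
        using HS(2) generic_polytope.interior_cells_iff[OF g] by blast
      have "x \<in> H'" using x sub[OF HS(3,4)] by blast
      then show ?thesis
        using HS x face_of_imp_subset
        by (intro subset_of_face_of[of H' P]) (auto simp: spanning_faces_def)
    qed
    show ?thesis
    proof (rule inj_onI, clarify)
      fix H S H' S'
      assume *: "H \<in> spanning" "S \<in> ?I H" "H' \<in> spanning" "S' \<in> ?I H'"
        "convex hull (insert ?v S) = convex hull (insert ?v S')"
      then have **: "S \<in> generic_polytope.interior_cells H c" "S' \<in> generic_polytope.interior_cells H' c"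
        using eq by auto
      have "S = S'" using rec[OF *(1) **(1)] rec[OF *(3) **(2)] *(5) by simp
      then show "H = H' \<and> S = S'" using same * ** by blast
    qed
  qed
  moreover have "finite spanning"
    unfolding spanning_faces_def by (rule finite_faces_of[OF polytope])
  moreover have "\<forall>H\<in>spanning. finite (?I H)"
  proof
    fix H assume H: "H \<in> spanning"
    then have "polytope H"
      using facesD(1)[OF spanning_faces_nonempty[OF assms H] polytope] by blast
    then have "finite (pointed_triangulation c H)" by (rule finite_pointed_triangulation)
    then show "finite (?I H)"
      unfolding interior_apex_simplexes_def by (rule finite_subset[rotated]) auto
  qed
  ultimately show ?thesis by (simp add: card_image)
qed

section \<open>First differences of polytope numbers\<close>

lemma aff_dim_nonneg: "aff_dim P \<ge> 0"
  using nonempty aff_dim_geq[of P] aff_dim_empty[of P] by linarith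

lemma interior_apex_simplexes_eq_empty:
  assumes "aff_dim P < int i"
  shows "interior_apex_simplexes c P i = {}"
proof -
  have "aff_dim S \<le> aff_dim P" if "S \<in> interior_cells" for S
    using interior_cell_subset[OF that] by (rule aff_dim_subset)
  then show ?thesis using assms by (force simp: interior_apex_simplexes_eq)
qed

lemma interior_apex_simplexes_0:
  "interior_apex_simplexes c P 0 = (if aff_dim P = 0 then {P} else {})"
proof -
  have "S = {apex c P}" if "S \<in> interior_apex_simplexes c P 0" for S
    using that by (auto simp: interior_apex_simplexes_def dest!: aff_dim_simplex)
      (auto simp: aff_dim_eq_0)
  moreover have "aff_dim P = 0" if "{apex c P} \<in> interior_apex_simplexes c P 0"
  proof -
    have "apex c P \<in> rel_interior P"
      using that by (auto simp: interior_apex_simplexes_def polytope_int_eq_rel_interior[OF polytope])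
    moreover have "{apex c P} face_of P"
      using apex_face(1)[OF P_face] by (simp add: face_of_singleton)
    ultimately have "{apex c P} = P" using in_face_rel_interior by blast
    then show ?thesis by (metis aff_dim_sing)
  qed
  moreover have "P = {apex c P}" "P \<in> interior_apex_simplexes c P 0" if "aff_dim P = 0"
  proof -
    show P: "P = {apex c P}" using that apex_in_P by (auto simp: aff_dim_eq_0)
    have "pointed_chain c P [P]" using P_face by (simp add: pointed_chain_def)
    moreover have "convex hull (apex c ` set [P]) = {apex c P}" by simp
    then have "convex hull (apex c ` set [P]) = P" using P by (rule trans[OF _ sym])
    moreover have "P \<inter> rel_interior P \<noteq> {}"
      using nonempty rel_interior_subset polytope_imp_convex[OF polytope]
      by (metis inf.absorb2 rel_interior_eq_empty)
    ultimately have "P \<in> interior_cells" unfolding interior_cells_iff by (metis list.sel(1))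
    then show "P \<in> interior_apex_simplexes c P 0"
      using that by (simp add: interior_apex_simplexes_eq)
  qed
  ultimately show ?thesis by auto
qed

text \<open>The defining equation of the interior numbers, solved for \<open>P\<close>. At
  \<open>n = 1\<close> the right-hand side would count the vertices, hence the bound on
  \<open>n\<close>.\<close>

lemma polytope_num_eq_sum_interior_num:
  assumes "n \<ge> 2"
  shows "polytope_num c P n = (\<Sum>F\<in>faces P. interior_num c F n)"
proof (cases "aff_dim P = 0")
  case True
  then obtain v where "P = {v}" by (auto simp: aff_dim_eq_0)
  then have "faces P = {P}" using P_face face_of_imp_subset by (auto simp: faces_def)
  then show ?thesis
    using polytope_num_rec(1)[OF polytope generic True] interior_num_rec(1)[OF polytope generic True]
    by simp
next
  case False
  then have "aff_dim P \<ge> 1" using aff_dim_nonneg by linarith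
  moreover have "finite (faces P)"
    unfolding faces_def by (rule finite_faces_of[OF polytope])
  ultimately show ?thesis
    using interior_num_rec(4)[OF polytope generic _ assms] P_face by (simp add: sum.remove)
qed

lemma polytope_num_1: "polytope_num c P 1 = 1"
proof (cases "aff_dim P = 0")
  case False
  then show ?thesis using polytope_num_rec(3)[OF polytope generic] aff_dim_nonneg by simp
qed (use polytope_num_rec(1)[OF polytope generic] in simp)

lemma polytope_num_0: "polytope_num c P 0 = 0"
proof (cases "aff_dim P = 0")
  case False
  then show ?thesis using polytope_num_rec(2)[OF polytope generic] aff_dim_nonneg by simp
qed (use polytope_num_rec(1)[OF polytope generic] in simp)

lemma finite_spanning: "finite spanning"
  unfolding spanning_faces_def by (rule finite_faces_of[OF polytope])

lemma generic_polytope_spanning: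
  "aff_dim P \<ge> 1 \<Longrightarrow> H \<in> spanning \<Longrightarrow> generic_polytope H c"
  using generic_polytope_face spanning_faces_nonempty by blast

lemma aff_dim_spanning_less: "H \<in> spanning \<Longrightarrow> aff_dim H < aff_dim P"
  using apex_in_P face_of_aff_dim_lt[OF polytope_imp_convex[OF polytope], of H]
  by (auto simp: spanning_faces_def)

text \<open>With \<open>d\<close> the dimension of \<open>P\<close>, the product
  \<open>- face_sign P * face_sign H\<close> is \<open>(-1)^(d - 1 - dim H)\<close>.\<close>

lemma polytope_num_Suc_diff:
  assumes d: "aff_dim P \<ge> 1"
  shows "polytope_num c P (Suc n) - polytope_num c P n =
    - face_sign P * (\<Sum>H\<in>spanning. face_sign H * polytope_num c H (Suc n))"
proof (cases "n = 0")
  case True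
  have "(\<Sum>H\<in>spanning. face_sign H * polytope_num c H (Suc n)) = (\<Sum>H\<in>spanning. face_sign H)"
  proof (intro sum.cong refl)
    fix H assume "H \<in> spanning"
    then have "polytope_num c H 1 = 1"
      using generic_polytope.polytope_num_1 generic_polytope_spanning[OF d] by blast
    then show "face_sign H * polytope_num c H (Suc n) = face_sign H" using True by simp
  qed
  \<comment> \<open>The instance \<open>G = {}\<close> of the sign sum.\<close>
  also have "\<dots> = - face_sign P"
    using sum_face_sign_spanning_faces[OF polytope apex_in_P empty_face_of] by simp
  finally show ?thesis using True polytope_num_0 polytope_num_1 by simp
next
  case False
  let ?m = "Suc n"
  let ?v = "apex c P"
  have m: "?m \<ge> 2" using False by simp
  let ?F = "{G \<in> faces P. ?v \<notin> G}"
  have finF: "finite ?F"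
    by (rule finite_subset[OF _ finite_faces_of[OF polytope, of "\<lambda>G. G \<noteq> {}"]]) (auto simp: faces_def)
  have "(\<Sum>H\<in>spanning. face_sign H * polytope_num c H ?m) =
      (\<Sum>H\<in>spanning. \<Sum>G | G \<in> ?F \<and> G \<subseteq> H. face_sign H * interior_num c G ?m)"
  proof (intro sum.cong refl)
    fix H assume H: "H \<in> spanning"
    have "faces H = {G. G \<in> ?F \<and> G \<subseteq> H}"
      using H face_of_face[of H P] by (auto simp: faces_def spanning_faces_def)
    then show "face_sign H * polytope_num c H ?m =
        (\<Sum>G | G \<in> ?F \<and> G \<subseteq> H. face_sign H * interior_num c G ?m)"
      using generic_polytope.polytope_num_eq_sum_interior_num[OF generic_polytope_spanning[OF d H] m]
      by (simp only: sum_distrib_left)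
  qed
  \<comment> \<open>After the exchange the signs of the spanning faces above a fixed
    \<open>G\<close> add up to a constant independent of \<open>G\<close>.\<close>
  also have "\<dots> = (\<Sum>G\<in>?F. \<Sum>H | H \<in> spanning \<and> G \<subseteq> H. face_sign H * interior_num c G ?m)"
    by (rule sum.swap_restrict[OF finite_spanning finF])
  also have "\<dots> = (\<Sum>G\<in>?F. - face_sign P * interior_num c G ?m)"
  proof (intro sum.cong refl)
    fix G assume "G \<in> ?F"
    then have "(\<Sum>H | H \<in> spanning \<and> G \<subseteq> H. face_sign H) = - face_sign P"
      by (intro sum_face_sign_spanning_faces[OF polytope apex_in_P]) (auto simp: faces_def)
    then show "(\<Sum>H | H \<in> spanning \<and> G \<subseteq> H. face_sign H * interior_num c G ?m) =
        - face_sign P * interior_num c G ?m"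
      by (simp only: sum_distrib_right[symmetric])
  qed
  also have "\<dots> = - face_sign P * (polytope_num c P ?m - polytope_num c P n)"
    using polytope_num_rec(4)[OF polytope generic d m] by (simp add: sum_distrib_left)
  finally have "(\<Sum>H\<in>spanning. face_sign H * polytope_num c H ?m) =
      - face_sign P * (polytope_num c P ?m - polytope_num c P n)" .
  then show ?thesis by (simp add: mult.assoc[symmetric])
qed

end

section \<open>Signed sums of simplex numbers\<close>

lemma simplex_num_Suc_Suc:
  "simplex_num (Suc j) (Suc m) = simplex_num (Suc j) m + simplex_num j (Suc m)"
  \<comment> \<open>Pascal's rule; for \<open>m = 0\<close> it reads 1 = 0 + 1 by the default value
    at 0.\<close>
  by (cases m) (auto simp: simplex_num_def)

text \<open>
  The range of summation is the same for all polytopes in the space; the terms with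
  \<open>i > aff_dim P\<close> vanish.
\<close>

definition signed_simplex_sum :: "'a::euclidean_space \<Rightarrow> 'a set \<Rightarrow> nat \<Rightarrow> int" where
  "signed_simplex_sum c P n =
     (\<Sum>i\<le>DIM('a). (-1) ^ i * int (card (interior_apex_simplexes c P i)) * int (simplex_num i n))"

lemma (in generic_polytope) signed_simplex_sum_Suc_diff:
  assumes d: "aff_dim P \<ge> 1"
  shows "signed_simplex_sum c P (Suc n) - signed_simplex_sum c P n =
    - (\<Sum>H\<in>spanning. signed_simplex_sum c H (Suc n))"
proof -
  let ?b = "\<lambda>Q i. int (card (interior_apex_simplexes c Q i))"
  let ?N = "DIM('a)"
  \<comment> \<open>The term \<open>i = 0\<close> vanishes in positive dimension; substituting
    \<open>i = j + 1\<close> yields the minus sign.\<close>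
  have shift: "signed_simplex_sum c P m =
      (\<Sum>j<?N. - ((-1) ^ j * ?b P (Suc j) * int (simplex_num (Suc j) m)))" for m
    unfolding signed_simplex_sum_def sum.atMost_shift using d by (simp add: interior_apex_simplexes_0)
  have "signed_simplex_sum c P (Suc n) - signed_simplex_sum c P n =
      (\<Sum>j<?N. - ((-1) ^ j * ?b P (Suc j) * int (simplex_num j (Suc n))))"
    unfolding shift sum_subtractf[symmetric]
    by (intro sum.cong refl) (simp add: simplex_num_Suc_Suc algebra_simps)
  also have "\<dots> = (\<Sum>j<?N. \<Sum>H\<in>spanning. - ((-1) ^ j * ?b H j * int (simplex_num j (Suc n))))"
    by (simp add: card_interior_apex_simplexes_Suc[OF d] sum_distrib_left sum_distrib_right sum_negf)
  also have "\<dots> = (\<Sum>H\<in>spanning. \<Sum>j<?N. - ((-1) ^ j * ?b H j * int (simplex_num j (Suc n))))"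
    by (rule sum.swap)
  also have "\<dots> = (\<Sum>H\<in>spanning. - signed_simplex_sum c H (Suc n))"
  proof (intro sum.cong refl)
    fix H assume H: "H \<in> spanning"
    \<comment> \<open>The sum for \<open>H\<close> also has a term \<open>j = ?N\<close>, which
      vanishes because \<open>H\<close> has smaller dimension than \<open>P\<close>.\<close>
    have "aff_dim H < int ?N"
      using aff_dim_spanning_less[OF H] aff_dim_le_DIM[of P] by linarith
    then have "?b H ?N = 0"
      using generic_polytope.interior_apex_simplexes_eq_empty[OF generic_polytope_spanning[OF d H]]
      by simp
    then show "(\<Sum>j<?N. - ((-1) ^ j * ?b H j * int (simplex_num j (Suc n)))) =
        - signed_simplex_sum c H (Suc n)"
      unfolding signed_simplex_sum_def lessThan_Suc_atMost[symmetric] by (simp add: sum_negf)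
  qed
  finally show ?thesis by (simp add: sum_negf)
qed

text \<open>Both sides vanish at \<open>n = 0\<close> and have equal first differences by the
  induction on the dimension, so an inner induction on \<open>n\<close> finishes.\<close>

lemma polytope_num_eq_signed_simplex_sum:
  assumes "generic_polytope P c"
  shows "polytope_num c P n = - face_sign P * signed_simplex_sum c P n"
  using assms
proof (induction "nat (aff_dim P + 1)" arbitrary: P n rule: less_induct)
  case less
  interpret generic_polytope P c by fact
  show ?case
  proof (cases "aff_dim P = 0")
    case True
    have "signed_simplex_sum c P n = (\<Sum>i\<in>{0}. (-1) ^ i *
        int (card (interior_apex_simplexes c P i)) * int (simplex_num i n))"
      unfolding signed_simplex_sum_def
      using True by (intro sum.mono_neutral_right) (auto simp: interior_apex_simplexes_eq_empty)
    then show ?thesis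
      using True polytope_num_rec(1)[OF polytope generic True, of n]
      by (simp add: interior_apex_simplexes_0 face_sign_def simplex_num_def)
  next
    case False
    then have d: "aff_dim P \<ge> 1" using aff_dim_nonneg by linarith
    show ?thesis
    proof (induction n)
      case 0
      then show ?case by (simp add: polytope_num_0 signed_simplex_sum_def simplex_num_def)
    next
      case (Suc n)
      have "face_sign H * polytope_num c H (Suc n) = - signed_simplex_sum c H (Suc n)"
        if H: "H \<in> spanning" for H
      proof -
        have "nat (aff_dim H + 1) < nat (aff_dim P + 1)"
          using aff_dim_spanning_less[OF H] d by linarith
        then have "polytope_num c H (Suc n) = - face_sign H * signed_simplex_sum c H (Suc n)"
          using less.hyps generic_polytope_spanning[OF d H] by blast
        then show ?thesis by (simp add: mult.assoc[symmetric])
      qed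
      then have sum_eq: "(\<Sum>H\<in>spanning. face_sign H * polytope_num c H (Suc n)) =
          signed_simplex_sum c P (Suc n) - signed_simplex_sum c P n"
        using signed_simplex_sum_Suc_diff[OF d, of n] by (simp add: sum_negf)
      then show ?case
        using polytope_num_Suc_diff[OF d, of n] Suc unfolding sum_eq by (simp add: algebra_simps)
    qed
  qed
qed

theorem theorem4p2:
  fixes P :: "'a::euclidean_space set" and c :: 'a and d n :: nat
  assumes "polytope P"
    and "aff_dim P = int d"
    and "d \<ge> 1"
    and "generic_on c P"
  shows "polytope_num c P n =
    (\<Sum>i=1..d. (-1) ^ (d - i) * int (card (interior_apex_simplexes c P i)) * int (simplex_num i n))"
proof -
  have "P \<noteq> {}" using assms(2) by auto
  then interpret generic_polytope P c using assms by unfold_locales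
  have "d \<le> DIM('a)" using assms(2) aff_dim_le_DIM[of P] by simp
  then have "signed_simplex_sum c P n = (\<Sum>i=1..d. (-1) ^ i *
      int (card (interior_apex_simplexes c P i)) * int (simplex_num i n))"
    unfolding signed_simplex_sum_def
  proof (intro sum.mono_neutral_right ballI)
    fix i assume "i \<in> {..DIM('a)} - {1..d}"
    then have "i = 0 \<or> aff_dim P < int i" using assms(2) by auto
    then have "interior_apex_simplexes c P i = {}"
      using interior_apex_simplexes_0 interior_apex_simplexes_eq_empty assms(2,3) by auto
    then show "(-1) ^ i * int (card (interior_apex_simplexes c P i)) * int (simplex_num i n) = 0"
      by simp
  qed auto
  then have "polytope_num c P n = (\<Sum>i=1..d. - face_sign P * ((-1) ^ i *
      int (card (interior_apex_simplexes c P i)) * int (simplex_num i n)))"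
    using polytope_num_eq_signed_simplex_sum[OF generic_polytope_axioms]
    by (simp only: sum_distrib_left)
  also have "\<dots> = (\<Sum>i=1..d. (-1) ^ (d - i) *
      int (card (interior_apex_simplexes c P i)) * int (simplex_num i n))"
  proof (intro sum.cong refl)
    fix i assume "i \<in> {1..d}"
    \<comment> \<open>\<open>- face_sign P\<close> is \<open>(-1)^d\<close>, and
      \<open>d + i\<close> and \<open>d - i\<close> have the same parity.\<close>
    then have "(-1 :: int) ^ d * (-1) ^ i = (-1) ^ (d - i + 2 * i)"
      by (simp add: add.commute flip: power_add)
    also have "\<dots> = (-1) ^ (d - i)" by (simp only: power_add power_mult) simp
    finally have "- face_sign P * (-1) ^ i = (-1) ^ (d - i)"
      using assms(2) by (simp add: face_sign_def nat_add_distrib)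
    then show "- face_sign P * ((-1) ^ i * int (card (interior_apex_simplexes c P i)) *
        int (simplex_num i n)) =
      (-1) ^ (d - i) * int (card (interior_apex_simplexes c P i)) * int (simplex_num i n)"
      by (simp only: mult.assoc[symmetric])
  qed
  finally show ?thesis .
qed

end
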